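(* Let $F$ be an ordered graph. The induced $F$-removal lemma has polynomial bounds if and only if $|V(F)|=2$, or $F \in \{D, D^{\leftarrow}, \overline{D}, \overline{D^{\leftarrow}}\}$.
   Context: An ordered graph is a graph with a linear order on its vertex set. An ordered graph $H$ is an induced subgraph of an ordered graph $G$ (an induced copy of $H$ in $G$) if there is an order-preserving injection $V(H)\to V(G)$ mapping edges to edges and non-edges to non-edges. An $n$-vertex ordered graph $G$ is $\varepsilon$-far from being induced $F$-free if one must add/delete at least $\varepsilon n^2$ edges of $G$ to obtain an ordered graph containing no induced copy of $F$. The induced $F$-removal lemma has polynomial bounds if there are constants $c, C>0$ (depending only on $F$) such that for every $\varepsilon\in(0,1)$ and every $n$, every $n$-vertex ordered graph which is $\varepsilon$-far from being induced $F$-free contains at least $c\,\varepsilon^{C} n^{v(F)}$ induced copies of $F$ (equivalently, the function $\delta_F(\varepsilon)$ in the induced removal lemma can be taken polynomial in $\varepsilon$). $D$ denotes the ordered graph with vertices $x<y<z$ and edges $\{x,y\},\{x,z\}$. For an ordered graph $G$, $\overline{G}$ is its complement (same vertex order) and $G^{\leftarrow}$ is obtained from $G$ by reversing the vertex order.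
   Formalization: F is assumed to have at least two vertices; for |V(F)| ≤ 1 the removal lemma trivially has polynomial bounds (n copies of the one-vertex graph, one copy of the empty graph), so the equivalence as printed fails there. *)

theory Defs
  imports Complex_Main
begin

text \<open>Finite simple graphs whose edges are two-element sets of vertices. The linear order on the
vertices is part of the structure (the reflexive relation \<open>vord\<close>, where
\<open>(u, v) \<in> vord G\<close> means \<open>u \<le> v\<close>) and is not taken from the type.\<close>

record 'a ograph =
  verts :: "'a set"
  edges :: "'a set set"
  vord :: "('a \<times> 'a) set"

definition all_pairs :: "'a set \<Rightarrow> 'a set set" where
  "all_pairs V = {{u, v} | u v. u \<in> V \<and> v \<in> V \<and> u \<noteq> v}"

definition ordered_graph :: "'a ograph \<Rightarrow> bool" where
  "ordered_graph G \<longleftrightarrow>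
     finite (verts G) \<and> edges G \<subseteq> all_pairs (verts G) \<and> linear_order_on (verts G) (vord G)"

definition graph_complement :: "'a ograph \<Rightarrow> 'a ograph" where
  "graph_complement G = G\<lparr>edges := all_pairs (verts G) - edges G\<rparr>"

definition graph_reverse :: "'a ograph \<Rightarrow> 'a ograph" where
  "graph_reverse G = G\<lparr>vord := (vord G)\<inverse>\<rparr>"

definition induced_embedding :: "('a \<Rightarrow> 'b) \<Rightarrow> 'a ograph \<Rightarrow> 'b ograph \<Rightarrow> bool" where
  "induced_embedding f H G \<longleftrightarrow>
     inj_on f (verts H) \<and> f ` verts H \<subseteq> verts G \<and>
     (\<forall>u\<in>verts H. \<forall>v\<in>verts H. (u, v) \<in> vord H \<longrightarrow> (f u, f v) \<in> vord G) \<and>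
     (\<forall>u\<in>verts H. \<forall>v\<in>verts H. u \<noteq> v \<longrightarrow> ({u, v} \<in> edges H \<longleftrightarrow> {f u, f v} \<in> edges G))"

text \<open>Copies are recorded by their vertex sets. A vertex set determines the embedding onto it,
because there is only one order-preserving bijection between two finite linear orders of the same
size.\<close>

definition induced_copies :: "'a ograph \<Rightarrow> 'b ograph \<Rightarrow> 'b set set" where
  "induced_copies H G = {f ` verts H | f. induced_embedding f H G}"

definition induced_free :: "'a ograph \<Rightarrow> 'b ograph \<Rightarrow> bool" where
  "induced_free F G \<longleftrightarrow> \<not> (\<exists>f. induced_embedding f F G)"

definition ograph_iso :: "'a ograph \<Rightarrow> 'b ograph \<Rightarrow> bool" (infix "\<cong>\<^sub>o" 50) where
  "G \<cong>\<^sub>o H \<longleftrightarrow> (\<exists>f. induced_embedding f G H \<and> f ` verts G = verts H)"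

text \<open>The graph \<open>G'\<close> ranges over all results of editing the edges of \<open>G\<close>; the number of edges added
or deleted is the size of the symmetric difference of the edge sets.\<close>

definition far_from_induced_free :: "real \<Rightarrow> 'a ograph \<Rightarrow> 'b ograph \<Rightarrow> bool" where
  "far_from_induced_free \<epsilon> F G \<longleftrightarrow>
     (\<forall>G'. ordered_graph G' \<and> verts G' = verts G \<and> vord G' = vord G \<and> induced_free F G' \<longrightarrow>
        real (card ((edges G - edges G') \<union> (edges G' - edges G))) \<ge> \<epsilon> * (real (card (verts G)))\<^sup>2)"

text \<open>The graphs \<open>G\<close> have natural numbers as vertices, with an arbitrary linear order
\<open>vord G\<close>. This is no restriction, since every finite ordered graph is isomorphic to such a
graph.\<close>

definition polynomial_induced_removal :: "'a ograph \<Rightarrow> bool" where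
  "polynomial_induced_removal F \<longleftrightarrow>
     (\<exists>c>0. \<exists>C>0. \<forall>\<epsilon>::real. 0 < \<epsilon> \<and> \<epsilon> < 1 \<longrightarrow>
       (\<forall>n. \<forall>G :: nat ograph.
          ordered_graph G \<and> card (verts G) = n \<and> far_from_induced_free \<epsilon> F G \<longrightarrow>
          real (card (induced_copies F G)) \<ge> c * \<epsilon> powr C * real n ^ card (verts F)))"

definition graph_D :: "nat ograph" where
  "graph_D = \<lparr>verts = {0, 1, 2}, edges = {{0, 1}, {0, 2}},
     vord = {(u, v). u \<in> {0, 1, 2} \<and> v \<in> {0, 1, 2} \<and> u \<le> v}\<rparr>"

lemma ordered_graph_complement: "ordered_graph G \<Longrightarrow> ordered_graph (graph_complement G)"
  by (auto simp: ordered_graph_def graph_complement_def)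

lemma ordered_graph_reverse: "ordered_graph G \<Longrightarrow> ordered_graph (graph_reverse G)"
  by (simp add: ordered_graph_def graph_reverse_def)

lemma ordered_graph_D: "ordered_graph graph_D"
proof -
  have "{0, 1} \<in> all_pairs {0, 1, 2 :: nat}" "{0, 2} \<in> all_pairs {0, 1, 2 :: nat}"
    unfolding all_pairs_def by fastforce+
  moreover have "linear_order_on (verts graph_D) (vord graph_D)"
    unfolding linear_order_on_def partial_order_on_def preorder_on_def refl_on_def trans_def
      antisym_def total_on_def graph_D_def by auto
  ultimately show ?thesis
    by (simp add: ordered_graph_def graph_D_def)
qed

end

theory Submission
  imports Defs "HOL-Library.FuncSet"
begin

text \<open>Positive direction. Up to reversal and complementation \<open>F\<close> is an edge or the fork
\<open>D\<close>; a graph is \<open>D\<close>-free iff the forward neighbourhood of every vertex is a clique. If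
there are few copies of \<open>D\<close>, then for most edges \<open>yz\<close> with \<open>y < z\<close> almost all of
the forward neighbourhood of \<open>y\<close> beyond \<open>z\<close> is contained in that of \<open>z\<close>. Sweep
the vertices from left to right, keeping a small set of active representatives that starts as a hitting
set: a vertex lying in the neighbourhoods of two active representatives, or whose own neighbourhood is
much larger than that of the active representative covering it, replaces those representatives. A
potential argument bounds the number of replacements polynomially in \<open>1/\<epsilon>\<close>, and the few
vertices where an inclusion fails are discarded. Afterwards every vertex can copy the neighbourhood
of a representative, and these neighbourhoods are cliques of the edited graph.

Negative direction. Behrend's construction in a fixed dimension, with vectors in place of integers: the
parts \<open>V\<^sub>0 < \<dots> < V\<^sub>k\<^sub>-\<^sub>1\<close> are copies of a box in
\<open>\<int>\<^sup>r\<close>, and planted copies of \<open>F\<close> are the progressions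
\<open>v, v + u, \<dots>, v + (k-1)u\<close> with \<open>u\<close> on a sphere. Any two points determine the
progression, so the planted copies are pair-disjoint, while strict convexity makes triples of points that are pairwise
joined by progressions rare. Choosing which pairs of parts are sensitive to the progressions,
and the common colour inside the parts, such that every copy of \<open>F\<close> contains such a triple,
refutes every polynomial bound. Such a choice exists for every other \<open>F\<close>: if three vertices span a
homogeneous triple it is immediate; otherwise \<open>k \<le> 5\<close> by Ramsey's theorem and the few remaining
patterns are checked by computation.\<close>

section \<open>Ordered graphs on initial segments of the natural numbers\<close>

text \<open>The order isomorphism with an initial segment of the naturals. It turns every question
  about order and adjacency into one about indices.\<close>

definition enumerates :: "(nat \<Rightarrow> 'a) \<Rightarrow> 'a ograph \<Rightarrow> bool" where
  "enumerates e G \<longleftrightarrow> bij_betw e {..<card (verts G)} (verts G) \<and>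
     (\<forall>i<card (verts G). \<forall>j<card (verts G). (e i, e j) \<in> vord G \<longleftrightarrow> i \<le> j)"

definition adjacent :: "(nat \<Rightarrow> 'a) \<Rightarrow> 'a ograph \<Rightarrow> nat \<Rightarrow> nat \<Rightarrow> bool" where
  "adjacent e G i j \<longleftrightarrow> {e i, e j} \<in> edges G"

definition opairs :: "nat \<Rightarrow> (nat \<times> nat) set" where
  "opairs n = {(x, y). x < y \<and> y < n}"

definition opair_edges :: "(nat \<Rightarrow> 'a) \<Rightarrow> 'a ograph \<Rightarrow> (nat \<times> nat) set" where
  "opair_edges h G = {(x, y) \<in> opairs (card (verts G)). {h x, h y} \<in> edges G}"

text \<open>A pattern \<open>f\<close> on \<open>k\<close> vertices and a graph \<open>A\<close> on
\<open>n\<close> vertices are only read at pairs in increasing order.\<close>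

definition pattern_embedding ::
    "nat \<Rightarrow> (nat \<Rightarrow> nat \<Rightarrow> bool) \<Rightarrow> nat \<Rightarrow> (nat \<times> nat) set \<Rightarrow> (nat \<Rightarrow> nat) \<Rightarrow> bool" where
  "pattern_embedding k f n A \<phi> \<longleftrightarrow> (\<forall>i<k. \<phi> i < n) \<and>
     (\<forall>i j. i < j \<longrightarrow> j < k \<longrightarrow> \<phi> i < \<phi> j \<and> ((\<phi> i, \<phi> j) \<in> A \<longleftrightarrow> f i j))"

definition pattern_copies ::
    "nat \<Rightarrow> (nat \<Rightarrow> nat \<Rightarrow> bool) \<Rightarrow> nat \<Rightarrow> (nat \<times> nat) set \<Rightarrow> nat set set" where
  "pattern_copies k f n A = {\<phi> ` {..<k} | \<phi>. pattern_embedding k f n A \<phi>}"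

definition far_from_pattern_free ::
    "real \<Rightarrow> nat \<Rightarrow> (nat \<Rightarrow> nat \<Rightarrow> bool) \<Rightarrow> nat \<Rightarrow> (nat \<times> nat) set \<Rightarrow> bool" where
  "far_from_pattern_free \<epsilon> k f n A \<longleftrightarrow>
     (\<forall>A' \<subseteq> opairs n. (\<nexists>\<phi>. pattern_embedding k f n A' \<phi>) \<longrightarrow>
        \<epsilon> * (real n)\<^sup>2 \<le> real (card (sym_diff A A')))"

definition polynomial_pattern_removal :: "nat \<Rightarrow> (nat \<Rightarrow> nat \<Rightarrow> bool) \<Rightarrow> bool" where
  "polynomial_pattern_removal k f \<longleftrightarrow>
     (\<exists>c>0. \<exists>C>0. \<forall>\<epsilon>::real. 0 < \<epsilon> \<longrightarrow> \<epsilon> < 1 \<longrightarrow>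
       (\<forall>n. \<forall>A \<subseteq> opairs n. far_from_pattern_free \<epsilon> k f n A \<longrightarrow>
          c * \<epsilon> powr C * real n ^ k \<le> real (card (pattern_copies k f n A))))"

lemma finite_opairs [simp]: "finite (opairs n)"
  by (rule finite_subset[of _ "{..<n} \<times> {..<n}"]) (auto simp: opairs_def)

text \<open>The number of strict predecessors grows strictly along the order, hence is a bijection
  from the vertices onto an initial segment; the enumeration is its inverse.\<close>

lemma ex_enumerates:
  assumes "ordered_graph G"
  shows "\<exists>e. enumerates e G"
proof -
  let ?V = "verts G" and ?r = "vord G"
  have fin: "finite ?V" and lin: "linear_order_on ?V ?r"
    using assms by (auto simp: ordered_graph_def)
  have refl: "\<And>x. x \<in> ?V \<Longrightarrow> (x, x) \<in> ?r"
    and tr: "\<And>x y z. (x, y) \<in> ?r \<Longrightarrow> (y, z) \<in> ?r \<Longrightarrow> (x, z) \<in> ?r"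
    and anti: "\<And>x y. (x, y) \<in> ?r \<Longrightarrow> (y, x) \<in> ?r \<Longrightarrow> x = y"
    and tot: "\<And>x y. x \<in> ?V \<Longrightarrow> y \<in> ?V \<Longrightarrow> x \<noteq> y \<Longrightarrow> (x, y) \<in> ?r \<or> (y, x) \<in> ?r"
    using lin unfolding linear_order_on_def partial_order_on_def preorder_on_def refl_on_def
      trans_def antisym_def total_on_def by blast+
  define D where "D v = {u \<in> ?V. u \<noteq> v \<and> (u, v) \<in> ?r}" for v
  have finD: "finite (D v)" for v using fin by (auto simp: D_def)
  have mono: "card (D u) < card (D v)" if "u \<in> ?V" "v \<in> ?V" "u \<noteq> v" "(u, v) \<in> ?r" for u v
  proof (rule psubset_card_mono[OF finD])
    have "u \<in> D v" "u \<notin> D u" using that by (auto simp: D_def)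
    moreover have "D u \<subseteq> D v"
    proof
      fix w assume "w \<in> D u"
      then have w: "w \<in> verts G" "w \<noteq> u" "(w, u) \<in> ?r" by (auto simp: D_def)
      then have "w \<noteq> v" using anti[of u v] that by blast
      then show "w \<in> D v" using w tr[OF w(3) that(4)] by (simp add: D_def)
    qed
    ultimately show "D u \<subset> D v" by blast
  qed
  have inj: "inj_on (\<lambda>v. card (D v)) ?V"
    by (rule inj_onI) (metis mono tot less_irrefl)
  have bound: "card (D v) < card ?V" if "v \<in> ?V" for v
    using that fin by (intro psubset_card_mono) (auto simp: D_def)
  have bij: "bij_betw (\<lambda>v. card (D v)) ?V {..<card ?V}"
    unfolding bij_betw_def
  proof
    show "(\<lambda>v. card (D v)) ` ?V = {..<card ?V}"
      by (rule card_subset_eq) (use bound inj in \<open>auto simp: card_image\<close>)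
  qed (rule inj)
  define e where "e = inv_into ?V (\<lambda>v. card (D v))"
  have be: "bij_betw e {..<card ?V} ?V" unfolding e_def by (rule bij_betw_inv_into[OF bij])
  have ed: "card (D (e i)) = i" if "i < card ?V" for i
    unfolding e_def using bij_betw_inv_into_right[OF bij] that by simp
  have "(e i, e j) \<in> ?r \<longleftrightarrow> i \<le> j" if "i < card ?V" "j < card ?V" for i j
  proof -
    have V: "e i \<in> ?V" "e j \<in> ?V" using be that by (auto simp: bij_betw_def)
    show ?thesis
      using mono[OF V] mono[OF V(2) V(1)] tot[OF V] refl[OF V(1)] ed[OF that(1)] ed[OF that(2)]
      by (metis leD less_imp_le order_refl)
  qed
  then show ?thesis using be by (auto simp: enumerates_def)
qed

text \<open>Conjugation of \<phi> with the two enumerations. The second conclusion keeps track of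
  the vertices hit, so that copies can be compared as vertex sets.\<close>

lemma induced_embedding_imp_pattern_embedding:
  assumes F: "enumerates e F" and G: "enumerates h G"
    and \<phi>: "induced_embedding \<phi> F G"
  obtains \<psi> where "pattern_embedding (card (verts F)) (adjacent e F) (card (verts G)) (opair_edges h G) \<psi>"
    and "\<And>i. i < card (verts F) \<Longrightarrow> \<phi> (e i) = h (\<psi> i)"
proof
  let ?k = "card (verts F)" and ?n = "card (verts G)"
  let ?\<psi> = "\<lambda>i. inv_into {..<?n} h (\<phi> (e i))"
  have eV: "e i \<in> verts F" if "i < ?k" for i
    using F that by (auto simp: enumerates_def bij_betw_def)
  have \<phi>V: "\<phi> (e i) \<in> verts G" if "i < ?k" for i
    using \<phi> eV[OF that] by (auto simp: induced_embedding_def)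
  have bh: "bij_betw h {..<?n} (verts G)" using G by (simp add: enumerates_def)
  show h: "\<phi> (e i) = h (?\<psi> i)" if "i < ?k" for i
    using bij_betw_inv_into_right[OF bh \<phi>V[OF that]] by simp
  have n: "?\<psi> i < ?n" if "i < ?k" for i
    using bij_betw_inv_into[OF bh] \<phi>V[OF that] by (auto simp: bij_betw_def)
  have "?\<psi> i < ?\<psi> j \<and> ((?\<psi> i, ?\<psi> j) \<in> opair_edges h G \<longleftrightarrow> adjacent e F i j)"
    if ij: "i < j" "j < ?k" for i j
  proof -
    have i: "i < ?k" using ij by simp
    have ne: "e i \<noteq> e j"
      using F ij i by (auto simp: enumerates_def bij_betw_def inj_on_def)
    have "(e i, e j) \<in> vord F" using F ij i by (auto simp: enumerates_def)
    then have "(\<phi> (e i), \<phi> (e j)) \<in> vord G"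
      using \<phi> eV[OF i] eV[OF ij(2)] by (auto simp: induced_embedding_def)
    then have le: "?\<psi> i \<le> ?\<psi> j"
      using G h[OF i] h[OF ij(2)] n[OF i] n[OF ij(2)] unfolding enumerates_def by metis
    have "\<phi> (e i) \<noteq> \<phi> (e j)"
      using \<phi> eV[OF i] eV[OF ij(2)] ne by (auto simp: induced_embedding_def inj_on_def)
    then have "?\<psi> i \<noteq> ?\<psi> j" using h[OF i] h[OF ij(2)] by metis
    moreover have "{e i, e j} \<in> edges F \<longleftrightarrow> {\<phi> (e i), \<phi> (e j)} \<in> edges G"
      using \<phi> eV[OF i] eV[OF ij(2)] ne by (auto simp: induced_embedding_def)
    ultimately show ?thesis
      using le h[OF i] h[OF ij(2)] n[OF ij(2)]
      by (auto simp: opair_edges_def adjacent_def opairs_def)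
  qed
  then show "pattern_embedding ?k (adjacent e F) ?n (opair_edges h G) ?\<psi>"
    using n by (auto simp: pattern_embedding_def)
qed

lemma pattern_embedding_imp_induced_embedding:
  assumes F: "enumerates e F" and G: "enumerates h G"
    and \<psi>: "pattern_embedding (card (verts F)) (adjacent e F) (card (verts G)) (opair_edges h G) \<psi>"
  obtains \<phi> where "induced_embedding \<phi> F G"
    and "\<And>i. i < card (verts F) \<Longrightarrow> \<phi> (e i) = h (\<psi> i)"
proof
  let ?k = "card (verts F)" and ?n = "card (verts G)"
  let ?\<phi> = "\<lambda>v. h (\<psi> (inv_into {..<?k} e v))"
  have be: "bij_betw e {..<?k} (verts F)" and bh: "bij_betw h {..<?n} (verts G)"
    using F G by (auto simp: enumerates_def)
  show h: "?\<phi> (e i) = h (\<psi> i)" if "i < ?k" for i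
    using bij_betw_inv_into_left[OF be] that by simp
  have n: "\<psi> i < ?n" if "i < ?k" for i using \<psi> that by (auto simp: pattern_embedding_def)
  have lt: "\<psi> i < \<psi> j" if "i < j" "j < ?k" for i j
    using \<psi> that by (auto simp: pattern_embedding_def)
  have \<psi>inj: "i = j" if "\<psi> i = \<psi> j" "i < ?k" "j < ?k" for i j
    using lt[of i j] lt[of j i] that by (metis less_irrefl linorder_neqE_nat)
  have hinj: "x = y" if "h x = h y" "x < ?n" "y < ?n" for x y
    using bh that by (auto simp: bij_betw_def inj_on_def)
  have \<phi>inj: "i = j" if "?\<phi> (e i) = ?\<phi> (e j)" "i < ?k" "j < ?k" for i j
  proof (rule \<psi>inj)
    show "\<psi> i = \<psi> j"
      by (rule hinj) (use that h[OF that(2)] h[OF that(3)] n in simp_all)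
  qed (use that in simp_all)
  have ord: "(h (\<psi> i), h (\<psi> j)) \<in> vord G" if "(e i, e j) \<in> vord F" "i < ?k" "j < ?k" for i j
  proof -
    have "i \<le> j" using F that by (auto simp: enumerates_def)
    then have "\<psi> i \<le> \<psi> j" using lt[of i j] that by (cases "i = j") auto
    then show ?thesis using G n that by (auto simp: enumerates_def)
  qed
  have edge: "{e i, e j} \<in> edges F \<longleftrightarrow> {h (\<psi> i), h (\<psi> j)} \<in> edges G"
    if "i < j" "j < ?k" for i j
    using \<psi> that by (auto simp: pattern_embedding_def opair_edges_def opairs_def adjacent_def)
  have edge': "{e i, e j} \<in> edges F \<longleftrightarrow> {h (\<psi> i), h (\<psi> j)} \<in> edges G"
    if "e i \<noteq> e j" "i < ?k" "j < ?k" for i j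
  proof (cases "i < j")
    case True then show ?thesis using edge that by simp
  next
    case False
    then have "j < i" using that by (metis linorder_neqE_nat)
    then show ?thesis using edge[of j i] that by (simp add: insert_commute)
  qed
  have V: "\<exists>i<?k. u = e i" if "u \<in> verts F" for u
    using that be by (auto simp: bij_betw_def)
  show "induced_embedding ?\<phi> F G"
    unfolding induced_embedding_def
  proof (intro conjI ballI impI)
    show "inj_on ?\<phi> (verts F)"
    proof (rule inj_onI)
      fix u v assume "u \<in> verts F" "v \<in> verts F" and eq: "?\<phi> u = ?\<phi> v"
      then obtain i j where ij: "i < ?k" "j < ?k" "u = e i" "v = e j" using V by metis
      then show "u = v" using \<phi>inj[OF eq[unfolded ij(3,4)] ij(1,2)] by simp
    qed
    show "?\<phi> ` verts F \<subseteq> verts G"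
    proof
      fix v assume "v \<in> ?\<phi> ` verts F"
      then obtain u where "u \<in> verts F" "v = ?\<phi> u" by blast
      then obtain i where i: "i < ?k" "v = ?\<phi> (e i)" using V by metis
      then show "v \<in> verts G" using h[OF i(1)] n[OF i(1)] bh by (auto simp: bij_betw_def)
    qed
  next
    fix u v assume uv: "u \<in> verts F" "v \<in> verts F" "(u, v) \<in> vord F"
    then obtain i j where ij: "i < ?k" "j < ?k" "u = e i" "v = e j" using V by metis
    show "(?\<phi> u, ?\<phi> v) \<in> vord G"
      unfolding ij(3,4) h[OF ij(1)] h[OF ij(2)] by (rule ord[OF _ ij(1,2)]) (use uv ij in simp)
  next
    fix u v assume uv: "u \<in> verts F" "v \<in> verts F" "u \<noteq> v"
    then obtain i j where ij: "i < ?k" "j < ?k" "u = e i" "v = e j" using V by metis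
    show "({u, v} \<in> edges F) = ({?\<phi> u, ?\<phi> v} \<in> edges G)"
      unfolding ij(3,4) h[OF ij(1)] h[OF ij(2)] by (rule edge'[OF _ ij(1,2)]) (use uv ij in simp)
  qed
qed

lemma induced_free_iff:
  assumes "enumerates e F" and "enumerates h G"
  shows "induced_free F G \<longleftrightarrow>
    (\<nexists>\<psi>. pattern_embedding (card (verts F)) (adjacent e F) (card (verts G)) (opair_edges h G) \<psi>)"
  unfolding induced_free_def
  using induced_embedding_imp_pattern_embedding[OF assms]
    pattern_embedding_imp_induced_embedding[OF assms] by metis

text \<open>The enumeration \<open>h\<close> acts injectively on vertex sets and carries the copies
  of the pattern onto the copies of \<open>F\<close>.\<close>

lemma card_induced_copies:
  assumes F: "enumerates e F" and G: "enumerates h G"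
  shows "card (induced_copies F G) =
    card (pattern_copies (card (verts F)) (adjacent e F) (card (verts G)) (opair_edges h G))"
proof -
  let ?k = "card (verts F)" and ?n = "card (verts G)"
  let ?C = "pattern_copies ?k (adjacent e F) ?n (opair_edges h G)"
  have V: "verts F = e ` {..<?k}" using F by (auto simp: enumerates_def bij_betw_def)
  have bh: "bij_betw h {..<?n} (verts G)" using G by (simp add: enumerates_def)
  have "induced_copies F G = (\<lambda>X. h ` X) ` ?C"
  proof (intro equalityI subsetI)
    fix X assume "X \<in> induced_copies F G"
    then obtain \<phi> where X: "X = \<phi> ` verts F" "induced_embedding \<phi> F G"
      by (auto simp: induced_copies_def)
    obtain \<psi> where \<psi>: "pattern_embedding ?k (adjacent e F) ?n (opair_edges h G) \<psi>"
      "\<And>i. i < ?k \<Longrightarrow> \<phi> (e i) = h (\<psi> i)"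
      using induced_embedding_imp_pattern_embedding[OF F G X(2)] by blast
    have "X = h ` \<psi> ` {..<?k}"
      unfolding X(1) by (subst V) (use \<psi>(2) in \<open>force simp: image_image\<close>)
    then show "X \<in> (\<lambda>X. h ` X) ` ?C" using \<psi>(1) by (auto simp: pattern_copies_def)
  next
    fix X assume "X \<in> (\<lambda>X. h ` X) ` ?C"
    then obtain \<psi> where X: "X = h ` \<psi> ` {..<?k}"
      and \<psi>: "pattern_embedding ?k (adjacent e F) ?n (opair_edges h G) \<psi>"
      by (auto simp: pattern_copies_def)
    obtain \<phi> where \<phi>: "induced_embedding \<phi> F G" "\<And>i. i < ?k \<Longrightarrow> \<phi> (e i) = h (\<psi> i)"
      using pattern_embedding_imp_induced_embedding[OF F G \<psi>] by blast
    have "X = \<phi> ` verts F"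
      unfolding X by (subst V) (use \<phi>(2) in \<open>force simp: image_image\<close>)
    then show "X \<in> induced_copies F G" using \<phi>(1) by (auto simp: induced_copies_def)
  qed
  moreover have "inj_on (\<lambda>X. h ` X) ?C"
  proof (rule inj_on_subset)
    show "inj_on (\<lambda>X. h ` X) (Pow {..<?n})"
      using bh by (intro inj_on_image_Pow) (simp add: bij_betw_def)
    show "?C \<subseteq> Pow {..<?n}" by (auto simp: pattern_copies_def pattern_embedding_def)
  qed
  ultimately show ?thesis by (simp add: card_image)
qed

lemma bij_betw_opairs_all_pairs:
  assumes "enumerates h G"
  shows "bij_betw (\<lambda>(x, y). {h x, h y}) (opairs (card (verts G))) (all_pairs (verts G))"
proof -
  let ?n = "card (verts G)"
  have bh: "bij_betw h {..<?n} (verts G)" using assms by (simp add: enumerates_def)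
  have inj: "h x = h y \<longleftrightarrow> x = y" if "x < ?n" "y < ?n" for x y
    using bh that by (auto simp: bij_betw_def inj_on_def)
  have "{h x, h y} \<in> all_pairs (verts G)" if "x < y" "y < ?n" for x y
    using inj[of x y] that bh unfolding all_pairs_def bij_betw_def by fastforce
  moreover have "P \<in> (\<lambda>(x, y). {h x, h y}) ` opairs ?n" if P: "P \<in> all_pairs (verts G)" for P
  proof -
    obtain u v where uv: "P = {u, v}" "u \<in> verts G" "v \<in> verts G" "u \<noteq> v"
      using P unfolding all_pairs_def by blast
    moreover have "verts G = h ` {..<?n}" using bh by (simp add: bij_betw_def)
    ultimately obtain x y where xy: "u = h x" "v = h y" "x < ?n" "y < ?n" by blast
    then have "(x, y) \<in> opairs ?n \<or> (y, x) \<in> opairs ?n"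
      using uv(4) by (cases x y rule: linorder_cases) (auto simp: opairs_def)
    then show ?thesis using xy(1,2) uv(1) by (force simp: insert_commute)
  qed
  moreover have "inj_on (\<lambda>(x, y). {h x, h y}) (opairs ?n)"
    by (rule inj_onI) (auto simp: opairs_def doubleton_eq_iff inj)
  ultimately show ?thesis by (auto simp: bij_betw_def opairs_def)
qed

text \<open>Edge sets and sets of increasing pairs correspond under a bijection, which preserves
  both freeness and the size of symmetric differences.\<close>

lemma far_iff:
  assumes F: "enumerates e F" and h: "enumerates h G" and G: "ordered_graph G"
  shows "far_from_induced_free \<epsilon> F G \<longleftrightarrow>
    far_from_pattern_free \<epsilon> (card (verts F)) (adjacent e F) (card (verts G)) (opair_edges h G)"
proof -
  let ?k = "card (verts F)" and ?n = "card (verts G)"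
  let ?m = "\<lambda>(x, y). {h x, h y}"
  note bij = bij_betw_opairs_all_pairs[OF h]
  have card: "card (sym_diff E E') = card (sym_diff B B')"
    if "E = ?m ` B" "E' = ?m ` B'" "B \<subseteq> opairs ?n" "B' \<subseteq> opairs ?n" for E E' B B'
  proof -
    have inj: "inj_on ?m (opairs ?n)" using bij by (simp add: bij_betw_def)
    have "?m ` (B - B') = ?m ` B - ?m ` B'"
      by (rule inj_on_image_set_diff[OF inj]) (use that(3,4) in auto)
    moreover have "?m ` (B' - B) = ?m ` B' - ?m ` B"
      by (rule inj_on_image_set_diff[OF inj]) (use that(3,4) in auto)
    ultimately have "sym_diff E E' = ?m ` sym_diff B B'"
      unfolding that(1,2) image_Un by simp
    moreover have "inj_on ?m (sym_diff B B')" using inj that by (auto intro: inj_on_subset)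
    ultimately show ?thesis by (metis card_image)
  qed
  have edges: "edges H = ?m ` opair_edges h H"
    if "ordered_graph H" "verts H = verts G" for H :: "'b ograph"
  proof -
    have img: "?m ` opairs ?n = all_pairs (verts G)" using bij by (simp add: bij_betw_def)
    show ?thesis
    proof (intro equalityI subsetI)
      fix E assume E: "E \<in> edges H"
      then have "E \<in> ?m ` opairs ?n" using that img by (auto simp: ordered_graph_def)
      then obtain p where "p \<in> opairs ?n" "E = ?m p" by blast
      then show "E \<in> ?m ` opair_edges h H"
        using E that by (cases p) (auto simp: opair_edges_def)
    qed (auto simp: opair_edges_def)
  qed
  have sub: "opair_edges h H \<subseteq> opairs ?n" if "verts H = verts G" for H :: "'b ograph"
    using that by (auto simp: opair_edges_def)
  have enum: "enumerates h H" if "verts H = verts G" "vord H = vord G" for H :: "'b ograph"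
    using h that by (simp add: enumerates_def)
  show ?thesis
  proof
    assume far: "far_from_induced_free \<epsilon> F G"
    show "far_from_pattern_free \<epsilon> ?k (adjacent e F) ?n (opair_edges h G)"
      unfolding far_from_pattern_free_def
    proof (intro allI impI)
      fix A' assume A': "A' \<subseteq> opairs ?n" and free: "\<nexists>\<phi>. pattern_embedding ?k (adjacent e F) ?n A' \<phi>"
      define H where "H = G\<lparr>edges := ?m ` A'\<rparr>"
      have H: "verts H = verts G" "vord H = vord G" "edges H = ?m ` A'" by (auto simp: H_def)
      have "?m ` A' \<subseteq> all_pairs (verts G)" using bij A' by (auto simp: bij_betw_def)
      then have og: "ordered_graph H" using G H by (auto simp: ordered_graph_def)
      have "?m p \<in> ?m ` A' \<longleftrightarrow> p \<in> A'" if "p \<in> opairs ?n" for p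
        by (rule inj_on_image_mem_iff[of ?m "opairs ?n"]) (use bij A' that in \<open>auto simp: bij_betw_def\<close>)
      then have oe: "opair_edges h H = A'"
        using A' H by (fastforce simp: opair_edges_def)
      have "induced_free F H"
        using induced_free_iff[OF F enum[OF H(1,2)]] free oe H by simp
      then have "\<epsilon> * (real ?n)\<^sup>2 \<le> real (card (sym_diff (edges G) (edges H)))"
        using far og H by (auto simp: far_from_induced_free_def)
      also have "card (sym_diff (edges G) (edges H)) = card (sym_diff (opair_edges h G) A')"
        by (rule card) (use edges[OF G] H A' sub in auto)
      finally show "\<epsilon> * (real ?n)\<^sup>2 \<le> real (card (sym_diff (opair_edges h G) A'))" .
    qed
  next
    assume far: "far_from_pattern_free \<epsilon> ?k (adjacent e F) ?n (opair_edges h G)"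
    show "far_from_induced_free \<epsilon> F G"
      unfolding far_from_induced_free_def
    proof (intro allI impI, elim conjE)
      fix H assume H: "ordered_graph H" "verts H = verts G" "vord H = vord G" "induced_free F H"
      have "\<nexists>\<psi>. pattern_embedding ?k (adjacent e F) ?n (opair_edges h H) \<psi>"
        using induced_free_iff[OF F enum[OF H(2,3)]] H(2,4) by simp
      then have "\<epsilon> * (real ?n)\<^sup>2 \<le> real (card (sym_diff (opair_edges h G) (opair_edges h H)))"
        using far sub[OF H(2)] by (simp add: far_from_pattern_free_def)
      also have "card (sym_diff (opair_edges h G) (opair_edges h H)) =
          card (sym_diff (edges G) (edges H))"
        by (rule card[symmetric]) (use edges G H sub in auto)
      finally show "\<epsilon> * (real ?n)\<^sup>2 \<le> real (card (sym_diff (edges G) (edges H)))" .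
    qed
  qed
qed

lemma polynomial_induced_removal_iff:
  assumes F: "enumerates e F"
  shows "polynomial_induced_removal F \<longleftrightarrow>
    polynomial_pattern_removal (card (verts F)) (adjacent e F)"
proof -
  let ?k = "card (verts F)" and ?f = "adjacent e F"
  \<comment> \<open>Any set of increasing pairs is the graph on 0, ..., n - 1 in the natural order,
    enumerated by the identity. This covers the converse direction of the translation.\<close>
  have to_graph: "\<exists>(G :: nat ograph) h. ordered_graph G \<and> enumerates h G \<and> card (verts G) = n \<and> opair_edges h G = A"
    if A: "A \<subseteq> opairs n" for A n
  proof (intro exI conjI)
    let ?G = "\<lparr>verts = {..<n}, edges = (\<lambda>(x, y). {x, y}) ` A,
      vord = {(u, v). u \<in> {..<n} \<and> v \<in> {..<n} \<and> u \<le> v}\<rparr>"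
    have "linear_order_on (verts ?G) (vord ?G)"
      unfolding linear_order_on_def partial_order_on_def preorder_on_def refl_on_def trans_def
        antisym_def total_on_def by auto
    moreover have "edges ?G \<subseteq> all_pairs (verts ?G)"
      using A unfolding all_pairs_def opairs_def by fastforce
    ultimately show "ordered_graph ?G" by (auto simp: ordered_graph_def)
    show "enumerates (\<lambda>x. x) ?G" by (auto simp: enumerates_def bij_betw_def)
    show "card (verts ?G) = n" by simp
    show "opair_edges (\<lambda>x. x) ?G = A"
      using A by (fastforce simp: opair_edges_def opairs_def doubleton_eq_iff)
  qed
  have 1: "(\<forall>n. \<forall>G :: nat ograph.
          ordered_graph G \<and> card (verts G) = n \<and> far_from_induced_free \<epsilon> F G \<longrightarrow>
          real (card (induced_copies F G)) \<ge> x * real n ^ ?k) \<longleftrightarrow>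
    (\<forall>n. \<forall>A \<subseteq> opairs n. far_from_pattern_free \<epsilon> ?k ?f n A \<longrightarrow>
          x * real n ^ ?k \<le> real (card (pattern_copies ?k ?f n A)))" (is "?L \<longleftrightarrow> ?R") for \<epsilon> x
  proof
    assume L: ?L
    show ?R
    proof (intro allI impI)
      fix n A assume A: "A \<subseteq> opairs n" "far_from_pattern_free \<epsilon> ?k ?f n A"
      obtain G :: "nat ograph" and h where G: "ordered_graph G" "enumerates h G" "card (verts G) = n" "opair_edges h G = A"
        using to_graph[OF A(1)] by blast
      then show "x * real n ^ ?k \<le> real (card (pattern_copies ?k ?f n A))"
        using L far_iff[OF F G(2,1), of \<epsilon>] card_induced_copies[OF F G(2)] A(2) by auto
    qed
  next
    assume R: ?R
    show ?L
    proof (intro allI impI, elim conjE)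
      fix n and G :: "nat ograph"
      assume G: "ordered_graph G" "card (verts G) = n" "far_from_induced_free \<epsilon> F G"
      obtain h where h: "enumerates h G" using ex_enumerates[OF G(1)] by blast
      have "opair_edges h G \<subseteq> opairs n" using G(2) by (auto simp: opair_edges_def)
      then show "x * real n ^ ?k \<le> real (card (induced_copies F G))"
        using R far_iff[OF F h G(1), of \<epsilon>] card_induced_copies[OF F h] G by auto
    qed
  qed
  show ?thesis
    unfolding polynomial_induced_removal_def polynomial_pattern_removal_def 1 imp_conjL 1[unfolded imp_conjL] ..
qed

lemma ograph_iso_iff:
  assumes F: "enumerates e F" and H: "enumerates h H"
    and oF: "ordered_graph F" and oH: "ordered_graph H"
  shows "F \<cong>\<^sub>o H \<longleftrightarrow> card (verts F) = card (verts H) \<and>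
    (\<forall>i j. i < j \<longrightarrow> j < card (verts F) \<longrightarrow> adjacent e F i j = adjacent h H i j)"
proof
  assume "F \<cong>\<^sub>o H"
  then obtain g where g: "induced_embedding g F H" "g ` verts F = verts H"
    by (auto simp: ograph_iso_def)
  let ?k = "card (verts F)"
  have k: "card (verts H) = ?k"
    using g card_image[of g "verts F"] by (auto simp: induced_embedding_def)
  obtain \<psi> where \<psi>: "pattern_embedding ?k (adjacent e F) ?k (opair_edges h H) \<psi>"
    using induced_embedding_imp_pattern_embedding[OF F H g(1)] k by metis
  have lt: "\<psi> i < \<psi> j" if "i < j" "j < ?k" for i j
    using \<psi> that by (auto simp: pattern_embedding_def)
  \<comment> \<open>A strictly increasing self-map of an initial segment is the identity: induction
    from the first index bounds it below, induction from the last index bounds it above.\<close>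
  have ge: "i \<le> \<psi> i" if "i < ?k" for i
    using that
  proof (induction i)
    case (Suc i) then show ?case using lt[of i "Suc i"] by auto
  qed simp
  have le: "\<psi> (?k - Suc i) \<le> ?k - Suc i" if "i < ?k" for i
    using that
  proof (induction i)
    case 0
    then have "\<psi> (?k - 1) < ?k" using \<psi> by (simp add: pattern_embedding_def)
    then show ?case by simp
  next
    case (Suc i)
    then show ?case using lt[of "?k - Suc (Suc i)" "?k - Suc i"] by fastforce
  qed
  have id: "\<psi> i = i" if "i < ?k" for i
    using ge[OF that] le[of "?k - Suc i"] that by simp
  show "?k = card (verts H) \<and> (\<forall>i j. i < j \<longrightarrow> j < ?k \<longrightarrow> adjacent e F i j = adjacent h H i j)"
    using \<psi> id k by (auto simp: pattern_embedding_def opair_edges_def adjacent_def opairs_def)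
next
  assume *: "card (verts F) = card (verts H) \<and>
    (\<forall>i j. i < j \<longrightarrow> j < card (verts F) \<longrightarrow> adjacent e F i j = adjacent h H i j)"
  then have "pattern_embedding (card (verts F)) (adjacent e F) (card (verts H)) (opair_edges h H) (\<lambda>i. i)"
    by (auto simp: pattern_embedding_def opair_edges_def adjacent_def opairs_def)
  then obtain \<phi> where \<phi>: "induced_embedding \<phi> F H"
    using pattern_embedding_imp_induced_embedding[OF F H] by blast
  have "card (\<phi> ` verts F) = card (verts H)"
    using \<phi> * by (simp add: induced_embedding_def card_image)
  then have "\<phi> ` verts F = verts H"
    using \<phi> oH by (intro card_subset_eq) (auto simp: induced_embedding_def ordered_graph_def)
  then show "F \<cong>\<^sub>o H" using \<phi> by (auto simp: ograph_iso_def)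
qed

section \<open>Removal of forks\<close>

text \<open>By averaging, some point of \<open>V\<close> lies in at least a fraction
  \<open>a\<close> of the sets \<open>Q y\<close> not yet hit. Adding it to \<open>R\<close> shrinks
  the unhit family by the factor \<open>1 - a\<close>.\<close>

lemma greedy_hitting_set:
  fixes Q :: "'b \<Rightarrow> 'a set" and a :: real
  assumes Y: "finite Y" and V: "finite V" "V \<noteq> {}" and a: "0 < a" "a \<le> 1"
    and Q: "\<And>y. y \<in> Y \<Longrightarrow> Q y \<subseteq> V" "\<And>y. y \<in> Y \<Longrightarrow> a * card V \<le> card (Q y)"
  shows "\<exists>R \<subseteq> (\<Union>y\<in>Y. Q y). finite R \<and> card R \<le> t \<and>
    real (card {y \<in> Y. Q y \<inter> R = {}}) \<le> (1 - a) ^ t * card Y"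
proof (induction t)
  case 0
  then show ?case by (intro exI[of _ "{}"]) auto
next
  case (Suc t)
  then obtain R where R: "R \<subseteq> (\<Union>y\<in>Y. Q y)" "finite R" "card R \<le> t"
    "real (card {y \<in> Y. Q y \<inter> R = {}}) \<le> (1 - a) ^ t * card Y" by auto
  define U where "U = {y \<in> Y. Q y \<inter> R = {}}"
  have U: "finite U" "U \<subseteq> Y" using Y by (auto simp: U_def)
  show ?case
  proof (cases "U = {}")
    case True
    then have "real (card {y \<in> Y. Q y \<inter> R = {}}) \<le> (1 - a) ^ Suc t * card Y"
      using a unfolding U_def by (simp only: card.empty) simp
    then show ?thesis using R(1,2,3) by (intro exI[of _ R]) auto
  next
    case False
    \<comment> \<open>Otherwise the incidences between \<open>U\<close> and \<open>V\<close>,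
      counted by points of \<open>V\<close>, would be fewer than the sizes of the sets
      \<open>Q y\<close> allow.\<close>
    have "\<exists>q\<in>V. a * card U \<le> card {y \<in> U. q \<in> Q y}"
    proof (rule ccontr)
      assume "\<not> ?thesis"
      then have "(\<Sum>q\<in>V. real (card {y \<in> U. q \<in> Q y})) < (\<Sum>q\<in>V. a * card U)"
        using V by (intro sum_strict_mono) auto
      also have "\<dots> = (\<Sum>y\<in>U. a * card V)" by simp
      also have "\<dots> \<le> (\<Sum>y\<in>U. real (card (Q y)))" using Q U by (intro sum_mono) auto
      also have "\<dots> = (\<Sum>y\<in>U. \<Sum>q\<in>V. if q \<in> Q y then 1 else 0)"
        using Q U V by (intro sum.cong) (auto simp: sum.If_cases Int_absorb1 subset_iff)
      also have "\<dots> = (\<Sum>q\<in>V. \<Sum>y\<in>U. if q \<in> Q y then 1 else 0)" by (rule sum.swap)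
      also have "\<dots> = (\<Sum>q\<in>V. real (card {y \<in> U. q \<in> Q y}))"
        using U by (intro sum.cong) (auto simp: sum.If_cases Int_def)
      finally show False by simp
    qed
    then obtain q where q: "q \<in> V" "a * card U \<le> card {y \<in> U. q \<in> Q y}" by blast
    have "0 < a * card U" using a False U by (simp add: card_gt_0_iff)
    with q have "card {y \<in> U. q \<in> Q y} \<noteq> 0" by linarith
    then have "{y \<in> U. q \<in> Q y} \<noteq> {}" by (metis card.empty)
    then have qQ: "q \<in> (\<Union>y\<in>Y. Q y)" using U by blast
    have eq: "{y \<in> Y. Q y \<inter> insert q R = {}} = U - {y \<in> U. q \<in> Q y}" by (auto simp: U_def)
    have "real (card (U - {y \<in> U. q \<in> Q y})) = real (card U) - real (card {y \<in> U. q \<in> Q y})"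
      using U by (subst card_Diff_subset) (auto intro!: of_nat_diff card_mono)
    also have "\<dots> \<le> (1 - a) * card U" using q by (simp add: algebra_simps)
    also have "\<dots> \<le> (1 - a) * ((1 - a) ^ t * card Y)"
      using R(4) a by (intro mult_left_mono) (auto simp: U_def)
    finally show ?thesis
      using R qQ eq card_insert_le_m1[of "Suc t" R q]
      by (intro exI[of _ "insert q R"]) (auto simp: mult.assoc)
  qed
qed

text \<open>If some element has rank at least \<open>m\<close>, take the least one: all its
  predecessors, at least \<open>m\<close> many, have small rank.\<close>

lemma card_small_rank:
  fixes X :: "nat set"
  assumes X: "finite X" and m: "m \<le> real (card X)"
  shows "m \<le> real (card {z \<in> X. real (card {w \<in> X. w < z}) < m})"
proof (cases "{z \<in> X. real (card {w \<in> X. w < z}) < m} = X")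
  case True
  then show ?thesis using m by simp
next
  case False
  define Z where "Z = {z \<in> X. real (card {w \<in> X. w < z}) < m}"
  define z where "z = Min (X - Z)"
  have ne: "finite (X - Z)" "X - Z \<noteq> {}" using False X by (auto simp: Z_def)
  have z: "z \<in> X - Z" unfolding z_def by (rule Min_in[OF ne])
  have "{w \<in> X. w < z} \<subseteq> Z"
    using Min_le[OF ne(1)] by (force simp: z_def)
  moreover have "finite Z" using X by (auto simp: Z_def)
  ultimately have "card {w \<in> X. w < z} \<le> card Z" by (intro card_mono)
  moreover have "m \<le> card {w \<in> X. w < z}" using z by (auto simp: Z_def)
  ultimately show ?thesis by (simp add: Z_def)
qed

section \<open>Representatives and the left-to-right sweep\<close>

text \<open>In the following \<open>N y\<close> is the forward neighbourhood of \<open>y\<close>, so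
\<open>later N s y - N y\<close> is the set of last vertices of the forks with first two vertices
\<open>s\<close> and \<open>y\<close>.\<close>

definition later :: "(nat \<Rightarrow> nat set) \<Rightarrow> nat \<Rightarrow> nat \<Rightarrow> nat set" where
  "later N s y = {w \<in> N s. y < w}"

text \<open>The vertices that begin more than \<open>h\<close> forks together with \<open>s\<close>.
  Beyond a neighbour \<open>z\<close> that is not bad, \<open>N s\<close> is contained in
  \<open>N z\<close> up to at most \<open>h\<close> exceptions.\<close>

definition bad_nbrs :: "(nat \<Rightarrow> nat set) \<Rightarrow> real \<Rightarrow> nat \<Rightarrow> nat set" where
  "bad_nbrs N h s = {z \<in> N s. h < card (later N s z - N z)}"

text \<open>The outcome of the sweep at a vertex \<open>y\<close>, where \<open>P\<close> is the set of all
representatives ever used and \<open>B\<close> the set of discarded vertices: \<open>None\<close> leaves the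
neighbourhood of \<open>y\<close> unconstrained, \<open>Some s\<close> prescribes that of \<open>s\<close>.\<close>

definition represented ::
    "(nat \<Rightarrow> nat set) \<Rightarrow> real \<Rightarrow> real \<Rightarrow> nat set \<Rightarrow> nat set \<Rightarrow> nat \<Rightarrow> nat option \<Rightarrow> bool" where
  "represented N g h B P y r \<longleftrightarrow> (case r of
     None \<Rightarrow> \<forall>s\<in>P. y \<notin> N s
   | Some s \<Rightarrow> s \<in> P \<and> real (card (N y - N s)) \<le> g \<and> real (card (later N s y - N y)) \<le> h \<and>
       (\<forall>s'\<in>P. y \<in> N s' \<longrightarrow> later N s' y - B \<subseteq> N s))"

text \<open>The quantity \<open>t + card (N s \<inter> {t..})\<close> does not decrease with the time
\<open>t\<close>, is at most \<open>n\<close>, and jumps by about \<open>g\<close> when a representative is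
replaced because its neighbourhood has become too small.\<close>

definition potential :: "nat \<Rightarrow> (nat \<Rightarrow> nat set) \<Rightarrow> nat \<Rightarrow> nat \<Rightarrow> real" where
  "potential n N t s = 2 * real n - (real t + card (N s \<inter> {t..}))"

text \<open>\<open>V0\<close> holds the vertices with too many bad neighbours, \<open>R\<close> the
  initial representatives; \<open>g\<close> is the excess of a neighbourhood that triggers a
  replacement, and \<open>h\<close> the number of exceptions tolerated in an inclusion.\<close>

context
  fixes N :: "nat \<Rightarrow> nat set" and n :: nat and V0 R :: "nat set" and g h :: real
  assumes N: "\<And>y. N y \<subseteq> {y<..<n}"
    and bad: "\<And>q. q < n \<Longrightarrow> q \<notin> V0 \<Longrightarrow> card (bad_nbrs N h q) \<le> h"
    and V0: "finite V0" and R: "R \<subseteq> {..<n}" "R \<inter> V0 = {}"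
    and h: "0 \<le> h" "h \<le> g / 2" and g: "0 < g" "g \<le> n"
begin

private lemma finN: "finite (N y)"
  by (rule finite_subset[OF N]) simp

private lemma finR: "finite R"
  using R by (auto intro: finite_subset)

text \<open>Invariant of the sweep at time \<open>t\<close> with active representatives \<open>S\<close>. Every
replacement lowers the sum of potentials by \<open>g / 2\<close>, which pays for the vertices discarded at
that moment; the term \<open>h * card S\<close> accounts for several representatives being replaced at
once.\<close>

private definition sweep :: "nat \<Rightarrow> nat set \<Rightarrow> nat set \<Rightarrow> nat set \<Rightarrow> (nat \<Rightarrow> nat option) \<Rightarrow> bool" where
  "sweep t S B P a \<longleftrightarrow> S \<subseteq> P \<and> P \<subseteq> {..<n} \<and> R \<subseteq> P \<and> finite B \<and> V0 \<subseteq> B \<and>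
     (\<forall>s\<in>P. bad_nbrs N h s \<subseteq> B) \<and>
     (\<forall>s\<in>P. \<exists>s'\<in>S. (N s - B) \<inter> {t..} \<subseteq> N s') \<and>
     card B + h * card S + 4 * h / g * (\<Sum>s\<in>S. potential n N t s) \<le>
       card V0 + 2 * h * card R + 4 * h / g * (2 * real n * card R) \<and>
     (\<forall>y<t. y \<notin> B \<longrightarrow> represented N g h B P y (a y))"

text \<open>Only the vertex \<open>t\<close> can leave the truncated neighbourhood, and the increase
  of the time makes up for it.\<close>

private lemma potential_Suc: "potential n N (Suc t) s \<le> potential n N t s"
proof -
  have "card (N s \<inter> {t..}) \<le> card (insert t (N s \<inter> {Suc t..}))"
    using finN by (intro card_mono) auto
  also have "\<dots> \<le> Suc (card (N s \<inter> {Suc t..}))"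
    using finN by (simp add: card_insert_if)
  finally have "card (N s \<inter> {t..}) \<le> Suc (card (N s \<inter> {Suc t..}))" .
  then show ?thesis by (simp add: potential_def)
qed

text \<open>This lower bound is what a representative releases when it is dropped without a
  successor.\<close>

private lemma potential_ge:
  assumes "t \<le> n"
  shows "n \<le> potential n N t s"
proof -
  have "card (N s \<inter> {t..}) \<le> card {t..<n}" using N[of s] by (intro card_mono) auto
  then show ?thesis using assms by (simp add: potential_def)
qed

text \<open>Of the budget \<open>2 * h * card R\<close>, one half pays for the bad neighbours of
  \<open>R\<close> and the other for the term \<open>h * card S\<close> with
  \<open>S = R\<close>.\<close>

private lemma sweep_0: "sweep 0 R (V0 \<union> (\<Union>q\<in>R. bad_nbrs N h q)) R (\<lambda>_. None)"
proof -
  have "card (\<Union>q\<in>R. bad_nbrs N h q) \<le> (\<Sum>q\<in>R. card (bad_nbrs N h q))"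
    by (rule card_UN_le[OF finR])
  then have "real (card (\<Union>q\<in>R. bad_nbrs N h q)) \<le> (\<Sum>q\<in>R. real (card (bad_nbrs N h q)))"
    by (metis of_nat_le_iff of_nat_sum)
  also have "\<dots> \<le> (\<Sum>q\<in>R. h)" using R bad by (intro sum_mono) auto
  finally have "card (V0 \<union> (\<Union>q\<in>R. bad_nbrs N h q)) \<le> card V0 + h * card R"
    using card_Un_le[of V0 "\<Union>q\<in>R. bad_nbrs N h q"] by (simp add: mult.commute)
  moreover have "(\<Sum>s\<in>R. potential n N 0 s) \<le> (\<Sum>s\<in>R. 2 * real n)"
    by (intro sum_mono) (simp add: potential_def)
  then have "4 * h / g * (\<Sum>s\<in>R. potential n N 0 s) \<le> 4 * h / g * (2 * real n * card R)"
    using h g by (intro mult_left_mono) (auto simp: mult.commute)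
  moreover have "finite (bad_nbrs N h q)" for q
    using finN by (auto simp: bad_nbrs_def)
  ultimately show ?thesis
    using R V0 finR by (auto simp: sweep_def)
qed

private lemma sweep_keep:
  assumes "sweep t S B P a" and "t \<notin> B \<Longrightarrow> represented N g h B P t r"
  shows "sweep (Suc t) S B P (a(t := r))"
proof -
  have "4 * h / g * (\<Sum>s\<in>S. potential n N (Suc t) s) \<le> 4 * h / g * (\<Sum>s\<in>S. potential n N t s)"
    using h g by (intro mult_left_mono sum_mono potential_Suc) auto
  moreover have "\<exists>s'\<in>S. (N s - B) \<inter> {Suc t..} \<subseteq> N s'" if s: "s \<in> P" for s
  proof -
    obtain s' where s': "s' \<in> S" "(N s - B) \<inter> {t..} \<subseteq> N s'"
      using assms(1) s unfolding sweep_def by blast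
    have "(N s - B) \<inter> {Suc t..} \<subseteq> (N s - B) \<inter> {t..}" by auto
    then show ?thesis using s' by (intro bexI[of _ s']) auto
  qed
  moreover have "represented N g h B P y ((a(t := r)) y)" if "y < Suc t" "y \<notin> B" for y
    using assms that by (cases "y = t") (auto simp: sweep_def)
  ultimately show ?thesis
    using assms(1) unfolding sweep_def by (intro conjI allI ballI impI) (linarith | blast)+
qed

text \<open>As \<open>t\<close> is not bad for \<open>s\<close>, \<open>N t\<close> contains
  \<open>N s\<close> beyond \<open>t\<close> up to \<open>h\<close> exceptions, and in addition the
  vertices of \<open>N t - N s\<close>. The loss of \<open>t\<close> itself is offset by the time
  step.\<close>

private lemma potential_new:
  assumes s: "t \<in> N s" and t: "t \<notin> bad_nbrs N h s"
  shows "potential n N (Suc t) t \<le> potential n N t s + h - card (N t - N s)"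
proof -
  have l: "finite (later N s t)" using finN by (simp add: later_def)
  have "card (later N s t - N t) \<le> h" using s t by (auto simp: bad_nbrs_def)
  moreover have "card (later N s t) = card (later N s t - N t) + card (later N s t \<inter> N t)"
    using card_Int_Diff[OF l, of "N t"] by simp
  moreover have "card (later N s t \<inter> N t) + card (N t - N s) \<le> card (N t)"
  proof -
    have "card (later N s t \<inter> N t) + card (N t - N s) = card ((later N s t \<inter> N t) \<union> (N t - N s))"
      using l finN by (intro card_Un_disjoint[symmetric]) (auto simp: later_def)
    also have "\<dots> \<le> card (N t)" using finN by (intro card_mono) auto
    finally show ?thesis .
  qed
  moreover have "N s \<inter> {t..} = insert t (later N s t)" using s by (auto simp: later_def)
  then have "card (N s \<inter> {t..}) = Suc (card (later N s t))"
    using l by (simp add: later_def)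
  moreover have "N t \<inter> {Suc t..} = N t" using N[of t] by auto
  ultimately show ?thesis by (simp add: potential_def)
qed

text \<open>The newly discarded vertices are at most \<open>h\<close> bad neighbours of
  \<open>t\<close> and at most \<open>h\<close> exceptions for each member of \<open>J\<close>. The
  term \<open>h * card S\<close> falls by at least \<open>h * card J - h\<close> and the potential
  term by at least \<open>2 * h\<close>, which together pay for exactly this.\<close>

private lemma sweep_replace:
  assumes sw: "sweep t S B P a" and t: "t < n" "t \<notin> B"
    and J: "J = {s \<in> S. t \<in> N s}"
    and cond: "2 \<le> card J \<or> (\<exists>s. J = {s} \<and> g \<le> card (N t - N s))"
  shows "sweep (Suc t) (insert t (S - J)) (B \<union> bad_nbrs N h t \<union> (\<Union>s\<in>J. later N s t - N t))
    (insert t P) (a(t := Some t))"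
proof -
  let ?B = "B \<union> bad_nbrs N h t \<union> (\<Union>s\<in>J. later N s t - N t)" and ?S = "insert t (S - J)"
  have SP: "S \<subseteq> P" "P \<subseteq> {..<n}" "R \<subseteq> P" "finite B" "V0 \<subseteq> B"
    and badB: "\<And>s. s \<in> P \<Longrightarrow> bad_nbrs N h s \<subseteq> B"
    and cover: "\<And>s. s \<in> P \<Longrightarrow> \<exists>s'\<in>S. (N s - B) \<inter> {t..} \<subseteq> N s'"
    and size: "card B + h * card S + 4 * h / g * (\<Sum>s\<in>S. potential n N t s) \<le>
       card V0 + 2 * h * card R + 4 * h / g * (2 * real n * card R)"
    and rep: "\<And>y. y < t \<Longrightarrow> y \<notin> B \<Longrightarrow> represented N g h B P y (a y)"
    using sw unfolding sweep_def by blast+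
  have finS: "finite S" using SP by (meson finite_lessThan finite_subset)
  then have finJ: "finite J" and JS: "J \<subseteq> S" by (auto simp: J)
  have Jbad: "t \<in> N s" "t \<notin> bad_nbrs N h s" if "s \<in> J" for s
    using that badB[of s] SP(1) t(2) by (auto simp: J)
  have finbad: "finite (bad_nbrs N h s)" for s using finN by (auto simp: bad_nbrs_def)
  have finl: "finite (later N s y)" for s y using finN by (simp add: later_def)

  have "J \<noteq> {}" using cond by auto
  then obtain s0 where s0: "s0 \<in> J" by blast
  \<comment> \<open>A second replaced representative releases at least \<open>n\<close>, which is at
    least \<open>g\<close>. A single one is replaced only if \<open>N t\<close> brings
    \<open>g\<close> new vertices, against a loss of at most \<open>h\<close>, which is at most
    \<open>g / 2\<close>.\<close>
  have drop: "potential n N (Suc t) t + g / 2 \<le> (\<Sum>s\<in>J. potential n N t s)"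
    using cond
  proof
    assume "\<exists>s. J = {s} \<and> g \<le> card (N t - N s)"
    then obtain s where s: "J = {s}" "g \<le> card (N t - N s)" by blast
    then show ?thesis using potential_new[OF Jbad, of s] h by simp
  next
    assume J2: "2 \<le> card J"
    have "(\<Sum>s\<in>J. potential n N t s) = potential n N t s0 + (\<Sum>s\<in>J - {s0}. potential n N t s)"
      using finJ s0 by (rule sum.remove)
    moreover have "(\<Sum>s\<in>J - {s0}. real n) \<le> (\<Sum>s\<in>J - {s0}. potential n N t s)"
      using t by (intro sum_mono potential_ge) simp
    moreover have "real n \<le> (\<Sum>s\<in>J - {s0}. real n)"
    proof -
      have "1 \<le> card (J - {s0})" using J2 s0 finJ by simp
      then have "1 * real n \<le> card (J - {s0}) * real n" by (intro mult_right_mono) auto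
      then show ?thesis by simp
    qed
    moreover have "potential n N (Suc t) t \<le> potential n N t s0 + h"
      using potential_new[OF Jbad[OF s0]] by simp
    ultimately show ?thesis using h g by linarith
  qed
  have "(\<Sum>s\<in>?S. potential n N (Suc t) s) \<le> potential n N (Suc t) t + (\<Sum>s\<in>S - J. potential n N (Suc t) s)"
  proof (cases "t \<in> S - J")
    case True
    have "0 \<le> potential n N (Suc t) t" using potential_ge[of "Suc t" t] t by simp
    then show ?thesis using True by (simp add: insert_absorb)
  next
    case False then show ?thesis using finS by simp
  qed
  also have "\<dots> \<le> potential n N (Suc t) t + (\<Sum>s\<in>S - J. potential n N t s)"
    by (intro add_left_mono sum_mono potential_Suc)
  also have "(\<Sum>s\<in>S - J. potential n N t s) = (\<Sum>s\<in>S. potential n N t s) - (\<Sum>s\<in>J. potential n N t s)"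
    using sum.subset_diff[OF JS finS, of "potential n N t"] by simp
  finally have "(\<Sum>s\<in>?S. potential n N (Suc t) s) \<le> (\<Sum>s\<in>S. potential n N t s) - g / 2"
    using drop by simp
  then have "4 * h / g * (\<Sum>s\<in>?S. potential n N (Suc t) s) \<le> 4 * h / g * ((\<Sum>s\<in>S. potential n N t s) - g / 2)"
    using h g by (intro mult_left_mono) auto
  then have pot: "4 * h / g * (\<Sum>s\<in>?S. potential n N (Suc t) s) \<le> 4 * h / g * (\<Sum>s\<in>S. potential n N t s) - 2 * h"
    using g by (simp add: right_diff_distrib)

  have cS: "card ?S + card J \<le> card S + 1"
  proof -
    have "card (S - J) + card J = card S"
      using finJ JS finS by (simp add: card_Diff_subset card_mono)
    moreover have "card ?S \<le> Suc (card (S - J))" using finS by (simp add: card_insert_if)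
    ultimately show ?thesis by simp
  qed
  have cS': "h * card ?S + h * card J \<le> h * card S + h"
  proof -
    have "h * real (card ?S + card J) \<le> h * real (card S + 1)"
      using cS h by (intro mult_left_mono) linarith+
    then show ?thesis by (simp add: algebra_simps)
  qed
  have "card (\<Union>s\<in>J. later N s t - N t) \<le> (\<Sum>s\<in>J. card (later N s t - N t))"
    by (rule card_UN_le[OF finJ])
  then have "real (card (\<Union>s\<in>J. later N s t - N t)) \<le> (\<Sum>s\<in>J. real (card (later N s t - N t)))"
    by (metis of_nat_le_iff of_nat_sum)
  also have "\<dots> \<le> (\<Sum>s\<in>J. h)"
    using Jbad by (intro sum_mono) (auto simp: bad_nbrs_def not_less)
  finally have "card (\<Union>s\<in>J. later N s t - N t) \<le> h * card J" by (simp add: mult.commute)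
  moreover have "card (bad_nbrs N h t) \<le> h" using bad t SP by blast
  moreover have "card ?B \<le> card B + card (bad_nbrs N h t) + card (\<Union>s\<in>J. later N s t - N t)"
    by (meson card_Un_le add_right_mono le_trans)
  ultimately have "card ?B \<le> card B + h + h * card J" by linarith
  with cS' pot size have size': "card ?B + h * card ?S + 4 * h / g * (\<Sum>s\<in>?S. potential n N (Suc t) s) \<le>
       card V0 + 2 * h * card R + 4 * h / g * (2 * real n * card R)" by linarith

  \<comment> \<open>If the representative covering \<open>s\<close> is itself replaced,
    \<open>t\<close> takes over its role; the vertices where this would fail have just been added to
    \<open>?B\<close>.\<close>
  have cover': "\<exists>s'\<in>?S. (N s - ?B) \<inter> {Suc t..} \<subseteq> N s'" if s: "s \<in> insert t P" for s
  proof (cases "s = t")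
    case False
    then obtain s' where s': "s' \<in> S" "(N s - B) \<inter> {t..} \<subseteq> N s'" using cover s by blast
    show ?thesis
    proof (cases "s' \<in> J")
      case True
      have "w \<in> N t" if w: "w \<in> (N s - ?B) \<inter> {Suc t..}" for w
      proof -
        have "w \<in> N s'" using w s'(2) by auto
        then have "w \<in> later N s' t" using w by (simp add: later_def)
        then show ?thesis using w True by blast
      qed
      then show ?thesis by (intro bexI[of _ t]) auto
    next
      case False
      have "(N s - ?B) \<inter> {Suc t..} \<subseteq> (N s - B) \<inter> {t..}" by auto
      then show ?thesis using s' False by (intro bexI[of _ s']) auto
    qed
  next
    case True
    then show ?thesis by (intro bexI[of _ t]) auto
  qed

  have rep': "represented N g h ?B (insert t P) y ((a(t := Some t)) y)"
    if y: "y < Suc t" "y \<notin> ?B" for y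
  proof (cases "y = t")
    case True
    \<comment> \<open>The representative covering \<open>s\<close> contains \<open>t\<close>, since
      \<open>t\<close> lies in \<open>N s\<close> outside \<open>B\<close>. Hence it belongs to
      \<open>J\<close>, and its exceptions are discarded.\<close>
    have "later N s y - ?B \<subseteq> N t" if s: "s \<in> P" "y \<in> N s" for s
    proof -
      obtain s' where s': "s' \<in> S" "(N s - B) \<inter> {t..} \<subseteq> N s'" using cover s by blast
      then have J': "s' \<in> J" using s True t by (auto simp: J)
      show ?thesis
      proof
        fix w assume w: "w \<in> later N s y - ?B"
        then have "w \<in> later N s' t" using s'(2) True by (auto simp: later_def)
        then show "w \<in> N t" using w J' by blast
      qed
    qed
    moreover have "later N t t - N t = {}" by (auto simp: later_def)
    then have "real (card (later N t t - N t)) \<le> h" using h by (simp only: card.empty of_nat_0)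
    moreover have "t \<notin> N t" using N[of t] by auto
    moreover have "real (card (N t - N t)) \<le> g" using g by (simp only: Diff_cancel card.empty of_nat_0)
    ultimately show ?thesis using True by (auto simp: represented_def simp del: Diff_cancel)
  next
    case False
    then have "y < t" using y by simp
    \<comment> \<open>Neighbourhoods point to the right, so the new representative \<open>t\<close>
      puts no condition on earlier vertices.\<close>
    then have "y \<notin> N t" using N[of t] by auto
    have r: "represented N g h B P y (a y)" using rep y \<open>y < t\<close> by blast
    show ?thesis
    proof (cases "a y")
      case None
      then show ?thesis using r False \<open>y \<notin> N t\<close> by (simp add: represented_def)
    next
      case (Some s)
      then have s: "s \<in> P" "card (N y - N s) \<le> g" "card (later N s y - N y) \<le> h"
        "\<And>s'. s' \<in> P \<Longrightarrow> y \<in> N s' \<Longrightarrow> later N s' y - B \<subseteq> N s"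
        using r by (auto simp: represented_def)
      have "later N s' y - ?B \<subseteq> N s" if "s' \<in> insert t P" "y \<in> N s'" for s'
        using s(4)[of s'] that \<open>y \<notin> N t\<close> by auto
      then show ?thesis using Some False s(1-3) by (simp add: represented_def)
    qed
  qed
  have "bad_nbrs N h s \<subseteq> ?B" if "s \<in> insert t P" for s
    using that badB[of s] by auto
  moreover have "finite ?B" using SP(4) finJ finbad finl by auto
  moreover have "?S \<subseteq> insert t P" "insert t P \<subseteq> {..<n}" "R \<subseteq> insert t P" "V0 \<subseteq> ?B"
    using SP t(1) by auto
  ultimately show ?thesis
    unfolding sweep_def using size' cover' rep' by (intro conjI allI ballI impI)
qed

text \<open>A vertex that is not discarded stays unconstrained if no active neighbourhood contains
  it, copies the only one containing it if its own excess is below \<open>g\<close>, and otherwise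
  becomes a representative.\<close>

private lemma ex_sweep: "t \<le> n \<Longrightarrow> \<exists>S B P a. sweep t S B P a"
proof (induction t)
  case 0
  then show ?case using sweep_0 by blast
next
  case (Suc t)
  then obtain S B P a where sw: "sweep t S B P a" by auto
  define J where "J = {s \<in> S. t \<in> N s}"
  have cover: "\<exists>s'\<in>S. (N s - B) \<inter> {t..} \<subseteq> N s'" "bad_nbrs N h s \<subseteq> B" if "s \<in> P" for s
    using sw that unfolding sweep_def by blast+
  have SP: "S \<subseteq> P" using sw by (simp add: sweep_def)
  have "finite S" using sw by (auto simp: sweep_def intro: finite_subset)
  then have finJ: "finite J" by (simp add: J_def)
  \<comment> \<open>For a neighbourhood that contains \<open>t\<close>, the covering active
    representative contains \<open>t\<close> as well, so only \<open>J\<close> matters.\<close>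
  have coverJ: "\<exists>s'\<in>J. later N s t - B \<subseteq> N s'" if s: "s \<in> P" "t \<in> N s" "t \<notin> B" for s
  proof -
    obtain s' where "s' \<in> S" "(N s - B) \<inter> {t..} \<subseteq> N s'" using cover s by blast
    then show ?thesis using s by (intro bexI[of _ s']) (auto simp: J_def later_def)
  qed
  consider "t \<in> B" | "t \<notin> B" "J = {}" | s where "t \<notin> B" "J = {s}" "\<not> g \<le> card (N t - N s)"
    | "t \<notin> B" "2 \<le> card J \<or> (\<exists>s. J = {s} \<and> g \<le> card (N t - N s))"
  proof -
    have "J = {} \<or> (\<exists>s. J = {s}) \<or> 2 \<le> card J"
    proof (cases "card J < 2")
      case True
      then have "card J = 0 \<or> card J = 1" by linarith
      then show ?thesis using finJ by (auto simp: card_1_singleton_iff)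
    qed simp
    then show ?thesis using that by blast
  qed
  then show ?case
  proof cases
    case 1
    then show ?thesis using sweep_keep[OF sw] by blast
  next
    case 2
    then have "represented N g h B P t None" using coverJ by (auto simp: represented_def)
    then show ?thesis using sweep_keep[OF sw] by blast
  next
    case (3 s)
    have s: "s \<in> P" "t \<in> N s" using 3 SP by (auto simp: J_def)
    then have "t \<notin> bad_nbrs N h s" using cover 3 by blast
    then have "represented N g h B P t (Some s)"
      using s coverJ 3 by (auto simp: represented_def bad_nbrs_def)
    then show ?thesis using sweep_keep[OF sw] by blast
  next
    case 4
    then show ?thesis using sweep_replace[OF sw _ _ J_def] Suc.prems by (metis Suc_le_lessD)
  qed
qed

text \<open>At the end of the sweep the potentials are still nonnegative, so the invariant bounds
  \<open>card B\<close> by the initial budget.\<close>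

lemma ex_representatives:
  "\<exists>B P a. finite B \<and> V0 \<subseteq> B \<and> R \<subseteq> P \<and>
     card B \<le> card V0 + 2 * h * card R + 8 * h * n * card R / g \<and>
     (\<forall>y<n. y \<notin> B \<longrightarrow> represented N g h B P y (a y))"
proof -
  obtain S B P a where sw: "sweep n S B P a" using ex_sweep by blast
  have "0 \<le> (\<Sum>s\<in>S. potential n N n s)"
    by (intro sum_nonneg order_trans[OF _ potential_ge]) auto
  then have "0 \<le> h * card S + 4 * h / g * (\<Sum>s\<in>S. potential n N n s)"
    using h g by (intro add_nonneg_nonneg mult_nonneg_nonneg divide_nonneg_nonneg) auto
  moreover have "4 * h / g * (2 * real n * card R) = 8 * h * n * card R / g" by simp
  ultimately have "card B \<le> card V0 + 2 * h * card R + 8 * h * n * card R / g"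
    using sw unfolding sweep_def by linarith
  then show ?thesis using sw unfolding sweep_def by blast
qed

end

section \<open>Counting forks and editing to a fork-free graph\<close>

definition fork_triples :: "nat \<Rightarrow> (nat \<Rightarrow> nat set) \<Rightarrow> (nat \<times> nat \<times> nat) set" where
  "fork_triples n N = (SIGMA x:{..<n}. SIGMA y:N x. later N x y - N y)"

text \<open>Since \<open>(1 - a) * (1 + a) \<le> 1\<close>, the power is at most the inverse of
  \<open>(1 + a) ^ t\<close>, and Bernoulli's inequality bounds the latter below by
  \<open>1 / a\<close>.\<close>

lemma Bernoulli_power_bound:
  fixes a :: real
  assumes "0 < a" "a \<le> 1" "1 / a\<^sup>2 \<le> real t"
  shows "(1 - a) ^ t \<le> a"
proof -
  have "1 + real t * a \<le> (1 + a) ^ t"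
    using Bernoulli_inequality[of a t] assms by simp
  moreover have "1 / a \<le> real t * a"
    using assms by (simp add: field_simps power2_eq_square)
  ultimately have "1 / a \<le> (1 + a) ^ t" by simp
  then have "(1 - a) ^ t * (1 / a) \<le> (1 - a) ^ t * (1 + a) ^ t"
    using assms by (intro mult_left_mono) auto
  also have "\<dots> = (1 - a\<^sup>2) ^ t"
    by (simp add: power_mult_distrib[symmetric] algebra_simps power2_eq_square)
  also have "\<dots> \<le> 1" using assms by (intro power_le_one) (auto simp: power_le_one)
  finally show ?thesis using assms by (simp add: field_simps)
qed

text \<open>A vertex with more than \<open>h\<close> bad neighbours is the first vertex of more than
  \<open>h * h\<close> forks.\<close>

lemma card_bad_vertices:
  fixes h :: real
  assumes N: "\<And>y. N y \<subseteq> {y<..<n}" and h: "0 \<le> h"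
  shows "h\<^sup>2 * card {y \<in> {..<n}. h < card (bad_nbrs N h y)} \<le> card (fork_triples n N)"
proof -
  let ?V0 = "{y \<in> {..<n}. h < card (bad_nbrs N h y)}"
  have fin: "finite (N y)" for y by (rule finite_subset[OF N]) simp
  have finl: "finite (later N x y - N y)" for x y using fin by (simp add: later_def)
  have "h\<^sup>2 * card ?V0 = (\<Sum>y\<in>?V0. h * h)" by (simp add: power2_eq_square)
  also have "\<dots> \<le> (\<Sum>y\<in>?V0. card (bad_nbrs N h y) * h)"
    using h by (intro sum_mono mult_right_mono) auto
  also have "\<dots> = (\<Sum>y\<in>?V0. \<Sum>z\<in>bad_nbrs N h y. h)" by simp
  also have "\<dots> \<le> (\<Sum>y\<in>?V0. \<Sum>z\<in>bad_nbrs N h y. real (card (later N y z - N z)))"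
    by (intro sum_mono) (auto simp: bad_nbrs_def)
  also have "\<dots> \<le> (\<Sum>y\<in>?V0. \<Sum>z\<in>N y. real (card (later N y z - N z)))"
    using fin by (intro sum_mono sum_mono2) (auto simp: bad_nbrs_def)
  also have "\<dots> \<le> (\<Sum>y<n. \<Sum>z\<in>N y. real (card (later N y z - N z)))"
    by (intro sum_mono2) (auto intro: sum_nonneg)
  also have "\<dots> = card (fork_triples n N)"
    using fin finl by (simp add: fork_triples_def card_SigmaI)
  finally show ?thesis .
qed

text \<open>An early neighbour \<open>z\<close> of \<open>y\<close> that is not bad misses only
  \<open>z\<close> itself, fewer than \<open>g / 2\<close> earlier neighbours and at most
  \<open>h\<close> ends of forks. About \<open>g / 2\<close> neighbours are early; removing
  \<open>V0\<close> and the bad ones leaves at least \<open>g / 4\<close>.\<close>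

lemma card_covering_nbrs:
  fixes g h :: real
  assumes N: "N y \<subseteq> {y<..<n}" and y: "y \<notin> V0" "g < card (N y)"
    and V0: "finite V0" "card V0 \<le> g / 10" and g: "1 \<le> g" and h: "h \<le> g / 10"
    and bad: "card (bad_nbrs N h y) \<le> h"
  shows "g / 4 \<le> card {q \<in> N y - V0. card (N y - N q) \<le> 2 * g}"
proof -
  have fin: "finite (N y)" by (rule finite_subset[OF N]) simp
  define Z where "Z = {z \<in> N y. real (card {w \<in> N y. w < z}) < g / 2}"
  have Z: "g / 2 \<le> card Z" using card_small_rank[OF fin, of "g / 2"] y g by (simp add: Z_def)
  have "Z \<subseteq> {q \<in> N y - V0. card (N y - N q) \<le> 2 * g} \<union> V0 \<union> bad_nbrs N h y"
  proof
    fix z assume z: "z \<in> Z"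
    show "z \<in> {q \<in> N y - V0. card (N y - N q) \<le> 2 * g} \<union> V0 \<union> bad_nbrs N h y"
    proof (cases "z \<in> V0 \<union> bad_nbrs N h y")
      case False
      let ?W = "{w \<in> N y. w < z}"
      have "N y - N z \<subseteq> insert z (?W \<union> (later N y z - N z))"
        by (auto simp: later_def)
      then have "card (N y - N z) \<le> card (insert z (?W \<union> (later N y z - N z)))"
        using fin by (intro card_mono) (auto simp: later_def)
      also have "\<dots> \<le> Suc (card (?W \<union> (later N y z - N z)))"
        by (rule card_insert_le_m1) auto
      also have "card (?W \<union> (later N y z - N z)) \<le> card ?W + card (later N y z - N z)"
        by (rule card_Un_le)
      finally have "real (card (N y - N z)) \<le> 1 + real (card ?W) + real (card (later N y z - N z))"
        by simp
      moreover have "card (later N y z - N z) \<le> h" using z False by (auto simp: bad_nbrs_def Z_def)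
      moreover have "card ?W < g / 2" using z by (auto simp: Z_def)
      ultimately have "card (N y - N z) \<le> 2 * g" using g h by linarith
      then show ?thesis using z False by (auto simp: Z_def)
    qed simp
  qed
  then have "card Z \<le> card ({q \<in> N y - V0. card (N y - N q) \<le> 2 * g} \<union> V0 \<union> bad_nbrs N h y)"
    using fin V0 by (intro card_mono) (auto simp: bad_nbrs_def)
  also have "\<dots> \<le> card {q \<in> N y - V0. card (N y - N q) \<le> 2 * g} + card V0 + card (bad_nbrs N h y)"
    by (meson card_Un_le add_right_mono le_trans)
  finally show ?thesis using Z V0 bad h g by linarith
qed

text \<open>Whenever it is nonempty, the new neighbourhood lies inside \<open>N s - B\<close> for a
  single \<open>s\<close> in \<open>P\<close>. In the unconstrained case this is achieved by
  intersecting with the neighbourhood of a representative that nearly covers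
  \<open>N y\<close>.\<close>

definition edited_nbrs ::
    "(nat \<Rightarrow> nat set) \<Rightarrow> real \<Rightarrow> nat set \<Rightarrow> nat set \<Rightarrow> (nat \<Rightarrow> nat option) \<Rightarrow> nat \<Rightarrow> nat set" where
  "edited_nbrs N c B P r y = (if y \<in> B then {} else case r y of
     Some s \<Rightarrow> later N s y - B
   | None \<Rightarrow> if \<exists>q\<in>P. real (card (N y - N q)) \<le> c
       then N y \<inter> N (SOME q. q \<in> P \<and> real (card (N y - N q)) \<le> c) - B else {})"

text \<open>All of the new neighbourhood of \<open>x\<close> lies in one \<open>N s\<close> with
  \<open>s\<close> in \<open>P\<close>. As \<open>y\<close> lies in \<open>N s\<close>, its outcome
  is not \<open>None\<close>, and \<open>represented\<close> puts what \<open>N s\<close> has beyond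
  \<open>y\<close>, outside \<open>B\<close>, into the prescribed neighbourhood.\<close>

lemma edited_nbrs_clique:
  fixes c g h :: real
  assumes rep: "\<And>y. y < n \<Longrightarrow> y \<notin> B \<Longrightarrow> represented N g h B P y (r y)"
    and N: "\<And>y. N y \<subseteq> {y<..<n}" and x: "x < n"
    and yz: "y \<in> edited_nbrs N c B P r x" "z \<in> edited_nbrs N c B P r x" "y < z"
  shows "z \<in> edited_nbrs N c B P r y"
proof -
  have "\<exists>s\<in>P. y \<in> N s - B \<and> z \<in> N s - B"
  proof (cases "r x")
    case (Some s)
    then have "s \<in> P" using rep[of x] x yz by (auto simp: represented_def edited_nbrs_def split: if_splits)
    then show ?thesis using Some yz by (auto simp: edited_nbrs_def later_def split: if_splits)
  next
    case None
    define q where "q = (SOME q. q \<in> P \<and> card (N x - N q) \<le> c)"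
    have ex: "\<exists>q. q \<in> P \<and> card (N x - N q) \<le> c"
      using None yz by (auto simp: edited_nbrs_def split: if_splits)
    then have "q \<in> P" unfolding q_def by (rule someI2_ex) blast
    moreover have "y \<in> N q - B" "z \<in> N q - B"
      using None yz by (auto simp: edited_nbrs_def q_def split: if_splits)
    ultimately show ?thesis by blast
  qed
  then obtain s where s: "s \<in> P" "y \<in> N s" "y \<notin> B" "z \<in> N s" "z \<notin> B" by blast
  then have "y < n" using N[of s] by auto
  then have "represented N g h B P y (r y)" using rep s by blast
  then show ?thesis using s yz(3)
    by (fastforce simp: represented_def edited_nbrs_def later_def split: option.splits)
qed

text \<open>Here \<open>U\<close> stands for exceptional vertices that no representative covers.
  Like those in \<open>B\<close> they may lose everything, at cost \<open>n\<close>; all other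
  vertices are edited cheaply.\<close>

lemma edited_nbrs_cost:
  fixes c g h :: real
  assumes rep: "y \<notin> B \<Longrightarrow> represented N g h B P y (r y)"
    and N: "\<And>y. N y \<subseteq> {y<..<n}" and B: "finite B" and c: "0 \<le> g" "g \<le> c" and h: "0 \<le> h"
    and y: "y \<in> B \<or> card (N y) \<le> c \<or> (\<exists>q\<in>P. card (N y - N q) \<le> c) \<or> y \<in> U"
  shows "real (card (sym_diff (N y) (edited_nbrs N c B P r y))) \<le>
    c + card B + h + (if y \<in> B \<union> U then real n else 0)"
proof -
  let ?E = "edited_nbrs N c B P r y"
  have fin: "finite (N y)" for y by (rule finite_subset[OF N]) simp
  have cN: "card (N y) \<le> n" using card_mono[OF _ N[of y]] by simp
  consider "y \<in> B" | s where "y \<notin> B" "r y = Some s"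
    | q where "y \<notin> B" "q \<in> P" "card (N y - N q) \<le> c" "?E = N y \<inter> N q - B"
    | "y \<notin> B" "?E = {}" "card (N y) \<le> c \<or> y \<in> U"
  proof (cases "y \<in> B \<or> (\<exists>s. r y = Some s)")
    case True then show ?thesis using that by blast
  next
    case False
    then have n: "y \<notin> B" "r y = None" by auto
    show ?thesis
    proof (cases "\<exists>q\<in>P. card (N y - N q) \<le> c")
      case True
      define q where "q = (SOME q. q \<in> P \<and> card (N y - N q) \<le> c)"
      have "q \<in> P \<and> card (N y - N q) \<le> c" unfolding q_def by (rule someI_ex) (use True in blast)
      moreover have "?E = N y \<inter> N q - B" using True n by (simp add: edited_nbrs_def q_def)
      ultimately show ?thesis using that(3) n by blast
    next
      case False
      then show ?thesis using that(4) n y by (auto simp: edited_nbrs_def)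
    qed
  qed
  then show ?thesis
  proof cases
    case 1
    then have "sym_diff (N y) ?E = N y" by (simp add: edited_nbrs_def)
    then show ?thesis using cN c h 1 by simp
  next
    case (2 s)
    then have s: "card (N y - N s) \<le> g" "card (later N s y - N y) \<le> h"
      using rep by (auto simp: represented_def)
    have "sym_diff (N y) ?E \<subseteq> (N y - N s) \<union> B \<union> (later N s y - N y)"
      using 2 N[of y] by (auto simp: edited_nbrs_def later_def)
    then have "card (sym_diff (N y) ?E) \<le> card ((N y - N s) \<union> B \<union> (later N s y - N y))"
      using fin B by (intro card_mono) (auto simp: later_def)
    also have "\<dots> \<le> card (N y - N s) + card B + card (later N s y - N y)"
      by (meson card_Un_le add_right_mono le_trans)
    finally show ?thesis using s c by auto
  next
    case (3 q)
    then have "sym_diff (N y) ?E \<subseteq> (N y - N q) \<union> B" by auto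
    then have "card (sym_diff (N y) ?E) \<le> card ((N y - N q) \<union> B)"
      using fin B by (intro card_mono) auto
    also have "\<dots> \<le> card (N y - N q) + card B" by (rule card_Un_le)
    finally show ?thesis using 3 c h by auto
  next
    case 4
    then show ?thesis using cN c h by auto
  qed
qed

lemma fork_removal:
  fixes \<epsilon> :: real
  assumes N: "\<And>y. N y \<subseteq> {y<..<n}" and \<epsilon>: "0 < \<epsilon>" "\<epsilon> < 1"
    and few: "card (fork_triples n N) < \<epsilon> ^ 9 / 10 ^ 16 * real n ^ 3"
    and some: "fork_triples n N \<noteq> {}"
  shows "\<exists>N'. (\<forall>y. N' y \<subseteq> {y<..<n}) \<and> (\<forall>x<n. \<forall>y\<in>N' x. \<forall>z\<in>N' x. y < z \<longrightarrow> z \<in> N' y) \<and>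
    (\<Sum>y<n. real (card (sym_diff (N y) (N' y)))) < \<epsilon> * (real n)\<^sup>2"
proof -
  have fin: "finite (N y)" for y by (rule finite_subset[OF N]) simp
  \<comment> \<open>Changing about \<open>g\<close> neighbours per vertex is affordable. The set
    \<open>Q y\<close> below has density at least \<open>a\<close>, which is
    \<open>g / (4 * n)\<close>, so \<open>card R\<close> is of order 1 / \<epsilon>^2; then
    \<open>h\<close> is small enough to make \<open>h * n * card R / g\<close> a small multiple of
    \<open>\<epsilon> * n\<close>.\<close>
  define g h a :: real where "g = \<epsilon> * n / 10" and "h = \<epsilon> ^ 4 * n / 10 ^ 7" and "a = \<epsilon> / 40"
  define t where "t = nat \<lceil>1 / a\<^sup>2\<rceil>"
  define V0 where "V0 = {y \<in> {..<n}. h < card (bad_nbrs N h y)}"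
  define Q where "Q y = {q \<in> N y - V0. card (N y - N q) \<le> 2 * g}" for y
  define Y where "Y = {y \<in> {..<n}. y \<notin> V0 \<and> g < card (N y)}"
  have pw: "\<epsilon> ^ k \<le> \<epsilon>" if "0 < k" for k
    using power_decreasing[of 1 k \<epsilon>] that \<epsilon> by simp
  have n0: "0 < n" using some by (auto simp: fork_triples_def)
  have "finite (fork_triples n N)" using fin by (auto simp: fork_triples_def later_def)
  then have "1 \<le> real (card (fork_triples n N))" using some by (simp add: card_gt_0_iff Suc_le_eq)
  \<comment> \<open>A single fork already forces \<open>n\<close> to be large in terms of
    \<epsilon>, so that \<open>g\<close> is at least 1.\<close>
  with few have big: "10 ^ 16 < \<epsilon> ^ 9 * real n ^ 3" by (simp add: field_simps)
  have g1: "1 \<le> g"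
  proof (rule ccontr)
    assume "\<not> 1 \<le> g"
    then have "\<epsilon> * n < 10" by (simp add: g_def)
    then have "(\<epsilon> * n) ^ 3 < 10 ^ 3" using \<epsilon> by (intro power_strict_mono) auto
    moreover have "\<epsilon> ^ 9 * real n ^ 3 \<le> (\<epsilon> * n) ^ 3"
      unfolding power_mult_distrib using \<epsilon> by (intro mult_right_mono power_decreasing) auto
    ultimately show False using big by simp
  qed
  have hle: "h \<le> \<epsilon> * n / 10 ^ 7" using pw[of 4] by (simp add: h_def mult_right_mono)
  have en: "0 < \<epsilon> * n" using \<epsilon> n0 by simp
  have h0: "0 < h" using \<epsilon> n0 by (simp add: h_def)
  have V0: "finite V0" by (simp add: V0_def)
  have "h\<^sup>2 * card V0 < h\<^sup>2 * (\<epsilon> * n / 100)"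
  proof -
    have "h\<^sup>2 * card V0 \<le> card (fork_triples n N)"
      unfolding V0_def by (rule card_bad_vertices[OF N less_imp_le[OF h0]])
    also note few
    \<comment> \<open>The exponent 9 and the constant in the hypothesis on forks are those that make
      \<open>V0\<close> smaller than \<open>\<epsilon> * n / 100\<close>.\<close>
    also have "\<epsilon> ^ 9 / 10 ^ 16 * real n ^ 3 = h\<^sup>2 * (\<epsilon> * n / 100)"
      by (simp add: h_def power2_eq_square power3_eq_cube eval_nat_numeral)
    finally show ?thesis .
  qed
  then have V0c: "card V0 < \<epsilon> * n / 100" using h0 by simp
  have a: "0 < a" "a \<le> 1" using \<epsilon> by (auto simp: a_def)
  have bad: "card (bad_nbrs N h q) \<le> h" if "q < n" "q \<notin> V0" for q
    using that by (auto simp: V0_def)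
  have QV: "Q y \<subseteq> {..<n}" for y using N[of y] by (auto simp: Q_def)
  have Qc: "a * card {..<n} \<le> card (Q y)" if "y \<in> Y" for y
  proof -
    have "g / 4 \<le> card (Q y)"
      unfolding Q_def
    proof (rule card_covering_nbrs[OF N _ _ V0 _ g1])
      show "card (bad_nbrs N h y) \<le> h" using that bad by (auto simp: Y_def)
      show "card V0 \<le> g / 10" using V0c by (simp add: g_def)
      show "h \<le> g / 10" using hle en by (simp add: g_def)
    qed (use that in \<open>auto simp: Y_def\<close>)
    then show ?thesis by (simp add: g_def a_def)
  qed
  obtain R where R: "R \<subseteq> (\<Union>y\<in>Y. Q y)" "finite R" "card R \<le> t"
    "real (card {y \<in> Y. Q y \<inter> R = {}}) \<le> (1 - a) ^ t * card Y"
  proof -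
    have "finite Y" "{..<n} \<noteq> {}" using n0 by (auto simp: Y_def)
    then have "\<exists>R\<subseteq>(\<Union>y\<in>Y. Q y). finite R \<and> card R \<le> t \<and>
        real (card {y \<in> Y. Q y \<inter> R = {}}) \<le> (1 - a) ^ t * card Y"
      using a QV Qc by (intro greedy_hitting_set[where V = "{..<n}"]) simp_all
    then show ?thesis by (elim exE conjE) (rule that)
  qed
  \<comment> \<open>The vertices missed by the hitting set; emptying their neighbourhoods costs at
    most \<open>a * n * n\<close>.\<close>
  define U where "U = {y \<in> Y. Q y \<inter> R = {}}"
  have U: "card U \<le> a * n"
  proof -
    have "(1 - a) ^ t \<le> a"
      using a by (intro Bernoulli_power_bound) (auto simp: t_def)
    moreover have "card Y \<le> n" using card_mono[of "{..<n}" Y] by (auto simp: Y_def)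
    ultimately have "(1 - a) ^ t * card Y \<le> a * n"
      using a by (intro mult_mono) auto
    then show ?thesis using R by (simp add: U_def)
  qed
  have Rc: "card R \<le> 3200 / \<epsilon>\<^sup>2"
  proof -
    have "1 \<le> 1 / a\<^sup>2" using a by (simp add: power_le_one)
    moreover have "real t \<le> 1 / a\<^sup>2 + 1" using a by (simp add: t_def)
    ultimately have "real t \<le> 2 / a\<^sup>2" by simp
    also have "\<dots> = 3200 / \<epsilon>\<^sup>2" by (simp add: a_def power2_eq_square)
    finally show ?thesis using R(3) by simp
  qed
  have gn: "g \<le> n" using \<epsilon> n0 by (simp add: g_def field_simps)
  have RV: "R \<subseteq> {..<n}" "R \<inter> V0 = {}" using R(1) QV by (auto simp: Q_def)
  obtain B P r where BP: "finite B" "V0 \<subseteq> B" "R \<subseteq> P"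
    "card B \<le> card V0 + 2 * h * card R + 8 * h * n * card R / g"
    and rep: "\<And>y. y < n \<Longrightarrow> y \<notin> B \<Longrightarrow> represented N g h B P y (r y)"
    using ex_representatives[OF N bad V0 RV less_imp_le[OF h0] _ _ gn] hle en g1
    by (auto simp: g_def)
  have Bc: "card B \<le> \<epsilon> * n / 20"
  proof -
    have "h * card R \<le> h * (3200 / \<epsilon>\<^sup>2)" using Rc h0 by (intro mult_left_mono) auto
    also have "\<dots> = \<epsilon>\<^sup>2 * n * 3200 / 10 ^ 7"
      using \<epsilon> by (simp add: h_def power2_eq_square eval_nat_numeral)
    finally have hR: "h * card R \<le> \<epsilon>\<^sup>2 * n * 3200 / 10 ^ 7" .
    also have "\<dots> \<le> \<epsilon> * n * 3200 / 10 ^ 7"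
      using pw[of 2] by (intro divide_right_mono mult_right_mono) auto
    finally have 1: "2 * h * card R \<le> \<epsilon> * n * 6400 / 10 ^ 7" by simp
    have "8 * h * n * card R / g = 80 / \<epsilon> * (h * card R)"
      using \<epsilon> n0 by (simp add: g_def field_simps)
    also have "\<dots> \<le> 80 / \<epsilon> * (\<epsilon>\<^sup>2 * n * 3200 / 10 ^ 7)"
      using hR \<epsilon> by (intro mult_left_mono) auto
    also have "\<dots> = \<epsilon> * n * 256000 / 10 ^ 7" using \<epsilon> by (simp add: power2_eq_square)
    finally show ?thesis using 1 BP(4) V0c by (simp add: field_simps)
  qed
  define N' where "N' = edited_nbrs N (2 * g) B P r"
  define N'' where "N'' y = (if y < n then N' y else {})" for y
  have sub: "N'' y \<subseteq> {y<..<n}" for y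
  proof
    fix z assume "z \<in> N'' y"
    then show "z \<in> {y<..<n}" using N
      by (fastforce simp: N''_def N'_def edited_nbrs_def later_def split: if_splits option.splits)
  qed
  have "real (card (sym_diff (N y) (N'' y))) \<le> 2 * g + card B + h + (if y \<in> B \<union> U then real n else 0)"
    if y: "y < n" for y
  proof -
    have "y \<in> B \<or> card (N y) \<le> 2 * g \<or> (\<exists>q\<in>P. card (N y - N q) \<le> 2 * g) \<or> y \<in> U"
    proof (cases "y \<in> Y - U")
      case True
      then obtain q where "q \<in> Q y" "q \<in> R" by (auto simp: U_def)
      then show ?thesis using BP(3) by (auto simp: Q_def)
    next
      case False
      then show ?thesis using y BP(2) g1 by (auto simp: Y_def)
    qed
    then show ?thesis
      unfolding N''_def N'_def using y rep[OF y] g1 h0 BP(1)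
      by (simp only: if_True) (rule edited_nbrs_cost[OF _ N], auto)
  qed
  then have "(\<Sum>y<n. real (card (sym_diff (N y) (N'' y)))) \<le>
      (\<Sum>y<n. 2 * g + card B + h + (if y \<in> B \<union> U then real n else 0))"
    by (intro sum_mono) auto
  also have "\<dots> = n * (2 * g + card B + h) + card ({..<n} \<inter> (B \<union> U)) * n"
    by (simp add: sum.distrib sum.If_cases Collect_disj_eq flip: Un_def)
  also have "\<dots> \<le> n * (2 * g + card B + h) + (card B + card U) * real n"
  proof -
    have "card ({..<n} \<inter> (B \<union> U)) \<le> card (B \<union> U)"
      using BP(1) by (intro card_mono) (auto simp: U_def Y_def)
    also have "\<dots> \<le> card B + card U" by (rule card_Un_le)
    finally have "card ({..<n} \<inter> (B \<union> U)) * n \<le> (card B + card U) * n" by (rule mult_right_mono) simp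
    then show ?thesis by (metis add_left_mono of_nat_add of_nat_le_iff of_nat_mult)
  qed
  also have "\<dots> = real n * (2 * g + 2 * card B + h + card U)" by (simp add: algebra_simps)
  also have "\<dots> < real n * (\<epsilon> * n)"
  proof (rule mult_strict_left_mono)
    show "2 * g + 2 * card B + h + card U < \<epsilon> * n"
      using U Bc hle en by (simp add: g_def a_def)
  qed (use n0 in simp)
  finally have "(\<Sum>y<n. real (card (sym_diff (N y) (N'' y)))) < \<epsilon> * (real n)\<^sup>2"
    by (simp add: power2_eq_square mult.commute mult.left_commute)
  moreover have "z \<in> N'' y" if "x < n" "y \<in> N'' x" "z \<in> N'' x" "y < z" for x y z
  proof -
    have "y < n" using sub[of x] that by auto
    then show ?thesis
      using edited_nbrs_clique[of n B N g h P r x y "2 * g" z] rep N that by (auto simp: N''_def N'_def)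
  qed
  ultimately show ?thesis using sub by blast
qed

section \<open>Invariance under complementation and reversal\<close>

lemma pattern_embedding_cong:
  assumes "\<And>i j. i < j \<Longrightarrow> j < k \<Longrightarrow> f i j = f' i j"
  shows "pattern_embedding k f n A \<phi> \<longleftrightarrow> pattern_embedding k f' n A \<phi>"
  using assms by (auto simp: pattern_embedding_def)

lemma polynomial_pattern_removal_cong:
  assumes "\<And>i j. i < j \<Longrightarrow> j < k \<Longrightarrow> f i j = f' i j"
  shows "polynomial_pattern_removal k f \<longleftrightarrow> polynomial_pattern_removal k f'"
  using pattern_embedding_cong[OF assms]
  by (simp add: polynomial_pattern_removal_def far_from_pattern_free_def pattern_copies_def)

text \<open>An involution of graphs that preserves edit distances and exchanges the copies of the
  two patterns transfers removal with the same constants.\<close>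

lemma polynomial_pattern_removal_transfer:
  assumes \<tau>: "\<And>n A. A \<subseteq> opairs n \<Longrightarrow> \<tau> n A \<subseteq> opairs n"
    and inv: "\<And>n A. A \<subseteq> opairs n \<Longrightarrow> \<tau> n (\<tau> n A) = A"
    and diff: "\<And>n A B. A \<subseteq> opairs n \<Longrightarrow> B \<subseteq> opairs n \<Longrightarrow>
      card (sym_diff (\<tau> n A) (\<tau> n B)) = card (sym_diff A B)"
    and emb: "\<And>n A. A \<subseteq> opairs n \<Longrightarrow>
      (\<exists>\<phi>. pattern_embedding k f' n A \<phi>) \<longleftrightarrow> (\<exists>\<phi>. pattern_embedding k f n (\<tau> n A) \<phi>)"
    and copies: "\<And>n A. A \<subseteq> opairs n \<Longrightarrow>
      card (pattern_copies k f' n A) = card (pattern_copies k f n (\<tau> n A))"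
    and removal: "polynomial_pattern_removal k f"
  shows "polynomial_pattern_removal k f'"
proof -
  have far: "far_from_pattern_free \<epsilon> k f n (\<tau> n A)"
    if A: "A \<subseteq> opairs n" and "far_from_pattern_free \<epsilon> k f' n A" for \<epsilon> n A
    unfolding far_from_pattern_free_def
  proof (intro allI impI)
    fix A' assume A': "A' \<subseteq> opairs n" "\<nexists>\<phi>. pattern_embedding k f n A' \<phi>"
    then have "\<nexists>\<phi>. pattern_embedding k f' n (\<tau> n A') \<phi>" using emb[OF \<tau>[OF A'(1)]] inv by simp
    then have "\<epsilon> * (real n)\<^sup>2 \<le> card (sym_diff A (\<tau> n A'))"
      using that \<tau>[OF A'(1)] by (simp add: far_from_pattern_free_def)
    then show "\<epsilon> * (real n)\<^sup>2 \<le> card (sym_diff (\<tau> n A) A')"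
      using diff[OF A \<tau>[OF A'(1)]] inv[OF A'(1)] by simp
  qed
  obtain c C where "0 < c" "0 < C" and *: "\<And>\<epsilon> n A. 0 < \<epsilon> \<Longrightarrow> \<epsilon> < 1 \<Longrightarrow> A \<subseteq> opairs n \<Longrightarrow>
      far_from_pattern_free \<epsilon> k f n A \<Longrightarrow> c * \<epsilon> powr C * real n ^ k \<le> card (pattern_copies k f n A)"
    using removal unfolding polynomial_pattern_removal_def by metis
  have "c * \<epsilon> powr C * real n ^ k \<le> card (pattern_copies k f' n A)"
    if "0 < \<epsilon>" "\<epsilon> < 1" "A \<subseteq> opairs n" "far_from_pattern_free \<epsilon> k f' n A" for \<epsilon> n A
    using *[OF that(1,2) \<tau>[OF that(3)] far[OF that(3,4)]] copies[OF that(3)] by simp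
  then show ?thesis
    unfolding polynomial_pattern_removal_def using \<open>0 < c\<close> \<open>0 < C\<close> by blast
qed

lemma polynomial_pattern_removal_complement:
  assumes "polynomial_pattern_removal k f"
  shows "polynomial_pattern_removal k (\<lambda>i j. \<not> f i j)"
proof (rule polynomial_pattern_removal_transfer[where \<tau> = "\<lambda>n A. opairs n - A", OF _ _ _ _ _ assms])
  have emb: "pattern_embedding k (\<lambda>i j. \<not> f i j) n A \<phi> \<longleftrightarrow> pattern_embedding k f n (opairs n - A) \<phi>"
    for n A \<phi>
    by (auto simp: pattern_embedding_def opairs_def)
  show "(\<exists>\<phi>. pattern_embedding k (\<lambda>i j. \<not> f i j) n A \<phi>) \<longleftrightarrow>
      (\<exists>\<phi>. pattern_embedding k f n (opairs n - A) \<phi>)" for n A by (simp add: emb)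
  show "card (pattern_copies k (\<lambda>i j. \<not> f i j) n A) = card (pattern_copies k f n (opairs n - A))"
    for n A by (simp add: pattern_copies_def emb)
  show "card (sym_diff (opairs n - A) (opairs n - B)) = card (sym_diff A B)"
    if "A \<subseteq> opairs n" "B \<subseteq> opairs n" for n A B
    using that by (intro arg_cong[where f = card]) auto
qed auto

definition reversed_pairs :: "nat \<Rightarrow> (nat \<times> nat) set \<Rightarrow> (nat \<times> nat) set" where
  "reversed_pairs n A = {(x, y) \<in> opairs n. (n - 1 - y, n - 1 - x) \<in> A}"

lemma polynomial_pattern_removal_reverse:
  assumes "polynomial_pattern_removal k f"
  shows "polynomial_pattern_removal k (\<lambda>i j. f (k - 1 - j) (k - 1 - i))"
proof (rule polynomial_pattern_removal_transfer[where \<tau> = reversed_pairs, OF _ _ _ _ _ assms])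
  let ?f' = "\<lambda>i j. f (k - 1 - j) (k - 1 - i)"
  \<comment> \<open>Both the pattern and the host are reflected. The patterns \<open>g\<close> and
    \<open>g'\<close> are kept general so that the statement serves both directions.\<close>
  have rev: "pattern_embedding k g' n (reversed_pairs n A) (\<lambda>i. n - 1 - \<phi> (k - 1 - i))"
    if \<phi>: "pattern_embedding k g n A \<phi>"
      and g: "\<And>i j. i < j \<Longrightarrow> j < k \<Longrightarrow> g' i j = g (k - 1 - j) (k - 1 - i)" for g g' n A \<phi>
    unfolding pattern_embedding_def
  proof (intro conjI allI impI)
    fix i assume "i < k"
    then show "n - 1 - \<phi> (k - 1 - i) < n" using \<phi> by (auto simp: pattern_embedding_def intro: le_less_trans)
  next
    fix i j assume ij: "i < j" "j < k"
    have lt: "\<phi> (k - 1 - i) < n" "\<phi> (k - 1 - j) < \<phi> (k - 1 - i)"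
      and A: "(\<phi> (k - 1 - j), \<phi> (k - 1 - i)) \<in> A \<longleftrightarrow> g (k - 1 - j) (k - 1 - i)"
      using \<phi> ij by (auto simp: pattern_embedding_def)
    have "n - 1 - (n - 1 - \<phi> (k - 1 - i)) = \<phi> (k - 1 - i)"
      "n - 1 - (n - 1 - \<phi> (k - 1 - j)) = \<phi> (k - 1 - j)" using lt by auto
    then show "n - 1 - \<phi> (k - 1 - i) < n - 1 - \<phi> (k - 1 - j)"
      "((n - 1 - \<phi> (k - 1 - i), n - 1 - \<phi> (k - 1 - j)) \<in> reversed_pairs n A) = g' i j"
      using lt A g[OF ij] by (auto simp: reversed_pairs_def opairs_def)
  qed
  show sub: "reversed_pairs n A \<subseteq> opairs n" for n A by (auto simp: reversed_pairs_def)
  show inv: "reversed_pairs n (reversed_pairs n A) = A" if "A \<subseteq> opairs n" for n A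
    using that by (auto simp: reversed_pairs_def opairs_def)
  show "card (sym_diff (reversed_pairs n A) (reversed_pairs n B)) = card (sym_diff A B)"
    if AB: "A \<subseteq> opairs n" "B \<subseteq> opairs n" for n A B
  proof (rule bij_betw_same_card)
    let ?h = "\<lambda>(x, y). (n - 1 - y, n - 1 - x)"
    show "bij_betw ?h (sym_diff (reversed_pairs n A) (reversed_pairs n B)) (sym_diff A B)"
      by (rule bij_betw_byWitness[where f' = ?h])
        (use AB in \<open>auto simp: reversed_pairs_def opairs_def\<close>)
  qed
  have f': "?f' i j = f (k - 1 - j) (k - 1 - i)" "f i j = ?f' (k - 1 - j) (k - 1 - i)"
    if "i < j" "j < k" for i j using that by auto
  have fwd: "pattern_embedding k f n (reversed_pairs n A) (\<lambda>i. n - 1 - \<phi> (k - 1 - i))"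
    if "pattern_embedding k ?f' n A \<phi>" for n A \<phi>
    by (rule rev[OF that f'(2)])
  have bwd: "pattern_embedding k ?f' n A (\<lambda>i. n - 1 - \<phi> (k - 1 - i))"
    if "A \<subseteq> opairs n" "pattern_embedding k f n (reversed_pairs n A) \<phi>" for n A \<phi>
    using rev[OF that(2) f'(1)] inv[OF that(1)] by simp
  show "(\<exists>\<phi>. pattern_embedding k ?f' n A \<phi>) \<longleftrightarrow>
      (\<exists>\<phi>. pattern_embedding k f n (reversed_pairs n A) \<phi>)" if "A \<subseteq> opairs n" for n A
    using fwd bwd[OF that] by blast
  have image: "(\<lambda>i. n - 1 - \<phi> (k - 1 - i)) ` {..<k} = (\<lambda>x. n - 1 - x) ` \<phi> ` {..<k}"
    for n and \<phi> :: "nat \<Rightarrow> nat"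
  proof -
    have "(\<lambda>i. k - 1 - i) ` {..<k} = {..<k}"
    proof
      show "{..<k} \<subseteq> (\<lambda>i. k - 1 - i) ` {..<k}"
        by (rule subsetI, rule_tac x = "k - 1 - x" in image_eqI) auto
    qed auto
    then have "(\<lambda>x. n - 1 - x) ` \<phi> ` {..<k} = (\<lambda>x. n - 1 - x) ` \<phi> ` (\<lambda>i. k - 1 - i) ` {..<k}"
      by simp
    then show ?thesis by (simp only: image_image)
  qed
  have undo: "(\<lambda>x. n - 1 - x) ` (\<lambda>x. n - 1 - x) ` X = X" if "X \<subseteq> {..<n}" for n and X :: "nat set"
  proof -
    have "(\<lambda>x. n - 1 - (n - 1 - x)) ` X = (\<lambda>x. x) ` X" using that by (intro image_cong) auto
    then show ?thesis by (simp only: image_image image_ident)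
  qed
  have bound: "X \<subseteq> {..<n}" if "X \<in> pattern_copies k g n A" for X g n A
    using that by (auto simp: pattern_copies_def pattern_embedding_def)
  have copies_fwd: "(\<lambda>x. n - 1 - x) ` X \<in> pattern_copies k f n (reversed_pairs n A)"
    if "X \<in> pattern_copies k ?f' n A" for n A X
  proof -
    obtain \<phi> where "X = \<phi> ` {..<k}" "pattern_embedding k ?f' n A \<phi>"
      using \<open>X \<in> pattern_copies k ?f' n A\<close> by (auto simp: pattern_copies_def)
    then show ?thesis using fwd image[of n \<phi>] unfolding pattern_copies_def by blast
  qed
  have copies_bwd: "(\<lambda>x. n - 1 - x) ` X \<in> pattern_copies k ?f' n A"
    if A: "A \<subseteq> opairs n" and X: "X \<in> pattern_copies k f n (reversed_pairs n A)" for n A X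
  proof -
    obtain \<phi> where "X = \<phi> ` {..<k}" "pattern_embedding k f n (reversed_pairs n A) \<phi>"
      using X by (auto simp: pattern_copies_def)
    then show ?thesis using bwd[OF A] image[of n \<phi>] unfolding pattern_copies_def by blast
  qed
  show "card (pattern_copies k ?f' n A) = card (pattern_copies k f n (reversed_pairs n A))"
    if "A \<subseteq> opairs n" for n A
  proof (rule bij_betw_same_card)
    show "bij_betw (\<lambda>X. (\<lambda>x. n - 1 - x) ` X) (pattern_copies k ?f' n A)
        (pattern_copies k f n (reversed_pairs n A))"
    proof (rule bij_betw_byWitness[where f' = "\<lambda>X. (\<lambda>x. n - 1 - x) ` X"])
      show "\<forall>X\<in>pattern_copies k ?f' n A. (\<lambda>x. n - 1 - x) ` (\<lambda>x. n - 1 - x) ` X = X"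
        by (intro ballI undo) (rule bound)
      show "\<forall>X\<in>pattern_copies k f n (reversed_pairs n A). (\<lambda>x. n - 1 - x) ` (\<lambda>x. n - 1 - x) ` X = X"
        by (intro ballI undo) (rule bound)
    qed (auto simp only: copies_fwd copies_bwd[OF that] image_subset_iff)
  qed
qed

section \<open>The positive cases: edges and forks\<close>

text \<open>Deleting all edges leaves no copy, so a far graph has at least
  \<open>\<epsilon> * n^2\<close> edges, each of them a copy.\<close>

lemma edge_removal:
  assumes "f 0 1"
  shows "polynomial_pattern_removal 2 f"
proof -
  have "\<epsilon> * (real n)\<^sup>2 \<le> card (pattern_copies 2 f n A)"
    if A: "A \<subseteq> opairs n" and far: "far_from_pattern_free \<epsilon> 2 f n A" for \<epsilon> n A
  proof -
    have "\<nexists>\<phi>. pattern_embedding 2 f n {} \<phi>"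
      using assms one_less_numeral_iff zero_less_one unfolding pattern_embedding_def
      by (metis empty_iff semiring_norm(76))
    then have "\<epsilon> * (real n)\<^sup>2 \<le> card (sym_diff A {})"
      using far unfolding far_from_pattern_free_def by (meson empty_subsetI)
    then have "\<epsilon> * (real n)\<^sup>2 \<le> card A" by simp
    also have "card A \<le> card (pattern_copies 2 f n A)"
    proof (rule card_inj_on_le)
      show "inj_on (\<lambda>(x, y). {x, y}) A"
        by (rule inj_on_subset[OF _ A], rule inj_onI) (auto simp: opairs_def doubleton_eq_iff)
      show "(\<lambda>(x, y). {x, y}) ` A \<subseteq> pattern_copies 2 f n A"
      proof clarify
        fix x y assume xy: "(x, y) \<in> A"
        then have "x < y" "y < n" using A by (auto simp: opairs_def)
        let ?\<phi> = "\<lambda>i :: nat. if i = 0 then x else y"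
        have "pattern_embedding 2 f n A ?\<phi>"
          using xy \<open>x < y\<close> \<open>y < n\<close> assms by (auto simp: pattern_embedding_def less_2_cases_iff)
        moreover have "{x, y} = ?\<phi> ` {..<2}" by (auto simp: less_2_cases_iff)
        ultimately show "{x, y} \<in> pattern_copies 2 f n A" unfolding pattern_copies_def by blast
      qed
      show "finite (pattern_copies 2 f n A)"
        by (rule finite_subset[of _ "Pow {..<n}"]) (auto simp: pattern_copies_def pattern_embedding_def)
    qed
    finally show ?thesis by simp
  qed
  then show ?thesis
    unfolding polynomial_pattern_removal_def
    by (intro exI[of _ 1] conjI exI[of _ "1 :: real"]) auto
qed

lemma fork_embedding:
  assumes "f 0 1" "f 0 2" "\<not> f 1 2"
  shows "pattern_embedding 3 f n A \<phi> \<longleftrightarrow> \<phi> 0 < \<phi> 1 \<and> \<phi> 1 < \<phi> 2 \<and> \<phi> 2 < n \<and>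
    (\<phi> 0, \<phi> 1) \<in> A \<and> (\<phi> 0, \<phi> 2) \<in> A \<and> (\<phi> 1, \<phi> 2) \<notin> A"
proof -
  have all: "(\<forall>i<3. P i) \<longleftrightarrow> P 0 \<and> P 1 \<and> P 2" for P :: "nat \<Rightarrow> bool"
    by (auto simp: numeral_3_eq_3 numeral_2_eq_2 less_Suc_eq)
  have all_pairs: "(\<forall>i j. i < j \<longrightarrow> j < 3 \<longrightarrow> Q i j) \<longleftrightarrow> Q 0 1 \<and> Q 0 2 \<and> Q 1 2" for Q :: "nat \<Rightarrow> nat \<Rightarrow> bool"
    by (auto simp: numeral_3_eq_3 numeral_2_eq_2 less_Suc_eq)
  show ?thesis
    unfolding pattern_embedding_def all all_pairs using assms by auto
qed

text \<open>The constants are those of \<open>fork_removal\<close>: with fewer copies it yields a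
  fork-free graph closer than farness permits.\<close>

theorem fork_pattern_removal:
  assumes f: "f 0 1" "f 0 2" "\<not> f 1 2"
  shows "polynomial_pattern_removal 3 f"
proof -
  have "1 / 10 ^ 16 * \<epsilon> powr 9 * real n ^ 3 \<le> card (pattern_copies 3 f n A)"
    if \<epsilon>: "0 < \<epsilon>" "\<epsilon> < 1" and A: "A \<subseteq> opairs n" and far: "far_from_pattern_free \<epsilon> 3 f n A" for \<epsilon> n A
  proof (rule ccontr)
    assume less: "\<not> ?thesis"
    define N where "N y = {z. (y, z) \<in> A}" for y
    have N: "N y \<subseteq> {y<..<n}" for y using A by (auto simp: N_def opairs_def)
    have "card (fork_triples n N) \<le> card (pattern_copies 3 f n A)"
    proof (rule card_inj_on_le)
      show "inj_on (\<lambda>(x, y, z). {x, y, z}) (fork_triples n N)"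
      proof (rule inj_onI)
        fix T T' assume T: "T \<in> fork_triples n N" "T' \<in> fork_triples n N"
          and eq: "(\<lambda>(x, y, z). {x, y, z}) T = (\<lambda>(x, y, z). {x, y, z}) T'"
        obtain x y z x' y' z' where xyz: "T = (x, y, z)" "T' = (x', y', z')" by (metis prod_cases3)
        have lt: "x < y" "y < z" "x' < y'" "y' < z'"
          using T N[of x] N[of x'] unfolding xyz fork_triples_def later_def by auto
        have set: "{x, y, z} = {x', y', z'}" using eq by (simp add: xyz)
        have "Min {x, y, z} = x" "Min {x', y', z'} = x'" "Max {x, y, z} = z" "Max {x', y', z'} = z'"
          using lt by auto
        then have "x = x'" "z = z'" using set by metis+
        moreover have "y \<in> {x', y', z'}" using set by blast
        ultimately show "T = T'" using lt by (auto simp: xyz)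
      qed
      show "(\<lambda>(x, y, z). {x, y, z}) ` fork_triples n N \<subseteq> pattern_copies 3 f n A"
      proof clarify
        fix x y z assume "(x, y, z) \<in> fork_triples n N"
        then have xyz: "x < y" "y < z" "z < n" "(x, y) \<in> A" "(x, z) \<in> A" "(y, z) \<notin> A"
          using A by (auto simp: fork_triples_def later_def N_def opairs_def)
        let ?\<phi> = "\<lambda>i :: nat. if i = 0 then x else if i = 1 then y else z"
        have "pattern_embedding 3 f n A ?\<phi>" using xyz by (simp add: fork_embedding[OF f])
        moreover have "{x, y, z} = ?\<phi> ` {..<3}"
          by (auto simp: lessThan_Suc numeral_3_eq_3)
        ultimately show "{x, y, z} \<in> pattern_copies 3 f n A" unfolding pattern_copies_def by blast
      qed
      show "finite (pattern_copies 3 f n A)"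
        by (rule finite_subset[of _ "Pow {..<n}"]) (auto simp: pattern_copies_def pattern_embedding_def)
    qed
    moreover have "\<epsilon> powr 9 = \<epsilon> ^ 9" using \<epsilon> by simp
    ultimately have few: "card (fork_triples n N) < \<epsilon> ^ 9 / 10 ^ 16 * real n ^ 3" using less by simp
    then have n0: "0 < n" by (cases n) auto
    have free: "\<nexists>\<phi>. pattern_embedding 3 f n B \<phi>"
      if B: "B \<subseteq> opairs n" "\<And>x y z. (x, y) \<in> B \<Longrightarrow> (x, z) \<in> B \<Longrightarrow> y < z \<Longrightarrow> (y, z) \<in> B" for B
      unfolding fork_embedding[OF f] using B(2) by blast
    have "\<exists>B\<subseteq>opairs n. (\<nexists>\<phi>. pattern_embedding 3 f n B \<phi>) \<and> card (sym_diff A B) < \<epsilon> * (real n)\<^sup>2"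
    proof (cases "fork_triples n N = {}")
      case True
      have "\<nexists>\<phi>. pattern_embedding 3 f n A \<phi>"
      proof (rule free[OF A])
        fix x y z assume xyz: "(x, y) \<in> A" "(x, z) \<in> A" "y < z"
        have "x < n" using subsetD[OF A xyz(1)] by (simp add: opairs_def)
        then have "(x, y, z) \<in> fork_triples n N" if "(y, z) \<notin> A"
          using that xyz by (simp add: fork_triples_def later_def N_def)
        then show "(y, z) \<in> A" using True by blast
      qed
      then show ?thesis using A \<epsilon> n0 by (intro exI[of _ A]) auto
    next
      case False
      obtain N' where N': "\<And>y. N' y \<subseteq> {y<..<n}"
        "\<forall>x<n. \<forall>y\<in>N' x. \<forall>z\<in>N' x. y < z \<longrightarrow> z \<in> N' y"
        "(\<Sum>y<n. real (card (sym_diff (N y) (N' y)))) < \<epsilon> * (real n)\<^sup>2"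
        using fork_removal[OF N \<epsilon> few False] by blast
      define B where "B = {(x, y). y \<in> N' x}"
      have B: "B \<subseteq> opairs n" using N'(1) by (fastforce simp: B_def opairs_def)
      have "\<nexists>\<phi>. pattern_embedding 3 f n B \<phi>"
      proof (rule free[OF B])
        fix x y z assume "(x, y) \<in> B" "(x, z) \<in> B" "y < z"
        moreover from this have "x < n" using B by (auto simp: opairs_def)
        ultimately show "(y, z) \<in> B" using N'(2) by (auto simp: B_def)
      qed
      moreover have "sym_diff A B = (SIGMA y:{..<n}. sym_diff (N y) (N' y))"
        using A B by (auto simp: N_def B_def opairs_def)
      moreover have "finite (sym_diff (N y) (N' y))" for y
        using N[of y] N'(1)[of y] by (meson finite_Diff finite_Un finite_greaterThanLessThan finite_subset)
      ultimately have "(\<nexists>\<phi>. pattern_embedding 3 f n B \<phi>) \<and> card (sym_diff A B) < \<epsilon> * (real n)\<^sup>2"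
        using N'(3) by (simp add: card_SigmaI)
      then show ?thesis using B by blast
    qed
    then show False using far by (auto simp: far_from_pattern_free_def not_less)
  qed
  then show ?thesis
    unfolding polynomial_pattern_removal_def
    by (intro exI[of _ "1 / 10 ^ 16"] conjI exI[of _ 9]) auto
qed

section \<open>Blow-ups along spheres\<close>

text \<open>In the graph built below \<open>t p q\<close> says that the adjacency between parts \<open>p\<close> and
\<open>q\<close> depends on whether the two vertices lie on a common progression, and \<open>c\<close> is the
adjacency inside the parts. An embedding of \<open>f\<close> induces the map \<open>\<psi>\<close> to the indices of
the parts; the conclusion provides three vertices that pairwise lie on progressions.\<close>

definition rigid_pattern ::
    "nat \<Rightarrow> (nat \<Rightarrow> nat \<Rightarrow> bool) \<Rightarrow> bool \<Rightarrow> (nat \<Rightarrow> nat \<Rightarrow> bool) \<Rightarrow> bool" where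
  "rigid_pattern k f c t \<longleftrightarrow> (\<forall>\<psi>. (\<forall>i<k. \<psi> i < k) \<longrightarrow>
     (\<forall>i j. i < j \<longrightarrow> j < k \<longrightarrow> \<psi> i \<le> \<psi> j \<and>
        (if \<psi> i = \<psi> j then f i j = c else f i j = f (\<psi> i) (\<psi> j) \<or> t (\<psi> i) (\<psi> j))) \<longrightarrow>
     (\<exists>a b d. a < b \<and> b < d \<and> d < k \<and> \<psi> a < \<psi> b \<and> \<psi> b < \<psi> d \<and>
        (\<forall>(i, j) \<in> {(a, b), (b, d), (a, d)}. t (\<psi> i) (\<psi> j) \<and> f i j = f (\<psi> i) (\<psi> j))))"

section \<open>Points on a sphere in a box\<close>

definition box :: "nat \<Rightarrow> nat \<Rightarrow> (nat \<Rightarrow> nat) set" where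
  "box r m = (\<Pi>\<^sub>E i\<in>{..<r}. {..<m})"

lemma card_box: "card (box r m) = m ^ r"
  by (simp add: box_def card_PiE)

lemma finite_box: "finite (box r m)"
  unfolding box_def by (intro finite_PiE) auto

lemma box_eqI: "v \<in> box r m \<Longrightarrow> w \<in> box r m' \<Longrightarrow> (\<And>i. i < r \<Longrightarrow> v i = w i) \<Longrightarrow> v = w"
  unfolding box_def by (rule PiE_ext[of v "{..<r}" "\<lambda>_. UNIV"]) (auto simp: PiE_def)

text \<open>Pigeonhole: squared norms in the box take fewer than \<open>r * d^2\<close>
  values.\<close>

lemma ex_large_sphere:
  assumes "0 < r" "0 < d"
  obtains S s where "S \<subseteq> box r d" "\<And>v. v \<in> S \<Longrightarrow> (\<Sum>i<r. (v i)\<^sup>2) = s"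
    "d ^ r \<le> r * d\<^sup>2 * card S"
proof -
  define S where "S s = {v \<in> box r d. (\<Sum>i<r. (v i)\<^sup>2) = s}" for s
  have "\<exists>s. d ^ r \<le> r * d\<^sup>2 * card (S s)"
  proof (rule ccontr)
    assume "\<not> ?thesis"
    then have lt: "r * d\<^sup>2 * card (S s) < d ^ r" for s by (simp add: not_le)
    have "(\<Sum>i<r. (v i)\<^sup>2) \<in> {..<r * d\<^sup>2}" if "v \<in> box r d" for v
    proof -
      have "(\<Sum>i<r. (v i)\<^sup>2) < (\<Sum>i<r. d\<^sup>2)"
        using that assms by (intro sum_strict_mono power_strict_mono) (auto simp: box_def PiE_def)
      then show ?thesis by simp
    qed
    then have "box r d = (\<Union>s<r * d\<^sup>2. S s)" by (auto simp: S_def)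
    then have "d ^ r \<le> (\<Sum>s<r * d\<^sup>2. card (S s))"
      using card_UN_le[of "{..<r * d\<^sup>2}" S] card_box[of r d] by simp
    then have "r * d\<^sup>2 * d ^ r \<le> (\<Sum>s<r * d\<^sup>2. r * d\<^sup>2 * card (S s))"
      by (simp add: sum_distrib_left[symmetric])
    also have "\<dots> < (\<Sum>s<r * d\<^sup>2. d ^ r)"
      using lt assms by (intro sum_strict_mono) (auto simp: lessThan_empty_iff)
    finally show False by simp
  qed
  then obtain s where "d ^ r \<le> r * d\<^sup>2 * card (S s)" by blast
  then show ?thesis by (intro that[of "S s" s]) (auto simp: S_def)
qed

text \<open>Expanding the squared norm of \<open>a * u + b * v\<close> shows that the inner product
  of \<open>u\<close> and \<open>v\<close> is \<open>s\<close>, so their distance is zero.\<close>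

lemma sphere_strictly_convex:
  fixes u v w :: "nat \<Rightarrow> nat"
  assumes sq: "(\<Sum>i<r. (u i)\<^sup>2) = s" "(\<Sum>i<r. (v i)\<^sup>2) = s" "(\<Sum>i<r. (w i)\<^sup>2) = s"
    and ab: "0 < a" "0 < b" and eq: "\<And>i. i < r \<Longrightarrow> a * u i + b * v i = (a + b) * w i"
    and i: "i < r"
  shows "u i = v i"
proof -
  let ?X = "\<Sum>i<r. int (u i) * int (v i)"
  have sq': "(\<Sum>i<r. (int (u i))\<^sup>2) = int s" "(\<Sum>i<r. (int (v i))\<^sup>2) = int s"
    "(\<Sum>i<r. (int (w i))\<^sup>2) = int s"
    using sq by (simp_all flip: of_nat_power of_nat_sum)
  have "(int (a + b))\<^sup>2 * int s = (\<Sum>i<r. (int ((a + b) * w i))\<^sup>2)"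
    by (simp add: sq'(3)[symmetric] sum_distrib_left power_mult_distrib)
  also have "\<dots> = (\<Sum>i<r. (int (a * u i + b * v i))\<^sup>2)" using eq by simp
  also have "\<dots> = (\<Sum>i<r. (int a)\<^sup>2 * (int (u i))\<^sup>2 + (int b)\<^sup>2 * (int (v i))\<^sup>2 +
      2 * int a * int b * (int (u i) * int (v i)))"
    by (intro sum.cong) (auto simp: power2_eq_square algebra_simps)
  also have "\<dots> = (int a)\<^sup>2 * int s + (int b)\<^sup>2 * int s + 2 * int a * int b * ?X"
    by (simp add: sum.distrib sum_distrib_left[symmetric] sq')
  finally have "2 * int a * int b * ?X = 2 * int a * int b * int s"
    by (simp only: of_nat_add power2_eq_square) algebra
  moreover have "2 * int a * int b \<noteq> 0" using ab by simp
  ultimately have X: "?X = int s" by (metis mult_left_cancel)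
  have "(\<Sum>i<r. (int (u i) - int (v i))\<^sup>2) =
      (\<Sum>i<r. (int (u i))\<^sup>2 + (int (v i))\<^sup>2 - 2 * (int (u i) * int (v i)))"
    by (intro sum.cong) (auto simp: power2_eq_square algebra_simps)
  also have "\<dots> = 0" using X sq' by (simp add: sum.distrib sum_subtractf sum_distrib_left[symmetric])
  finally have "\<forall>i\<in>{..<r}. (int (u i) - int (v i))\<^sup>2 = 0"
    by (subst (asm) sum_nonneg_eq_0_iff) auto
  then show ?thesis using i by simp
qed

section \<open>The blow-up graph, its copies and its distance from being free\<close>

text \<open>The vertices are numbers below \<open>k * M\<close>: part \<open>p\<close> is an
  interval of length \<open>M\<close>, whose members encode vectors through \<open>dec\<close>. The
  box has side \<open>k * d\<close> so that it contains every progression starting in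
  \<open>box r d\<close> with direction in \<open>S\<close>.\<close>

locale sphere_blowup =
  fixes k r d :: nat and S :: "(nat \<Rightarrow> nat) set" and s :: nat
    and dec :: "nat \<Rightarrow> nat \<Rightarrow> nat"
    and f t :: "nat \<Rightarrow> nat \<Rightarrow> bool" and c :: bool
  assumes k: "3 \<le> k" and r: "0 < r" and d: "0 < d"
    and S: "S \<subseteq> box r d" and sphere: "\<And>v. v \<in> S \<Longrightarrow> (\<Sum>i<r. (v i)\<^sup>2) = s"
    and dec: "bij_betw dec {..<(k * d) ^ r} (box r (k * d))"
    and rigid: "rigid_pattern k f c t"
begin

definition M :: nat where "M = (k * d) ^ r"

definition part :: "nat \<Rightarrow> nat" where "part x = x div M"

definition vec :: "nat \<Rightarrow> nat \<Rightarrow> nat" where "vec x = dec (x mod M)"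

definition point :: "nat \<Rightarrow> (nat \<Rightarrow> nat) \<Rightarrow> nat" where
  "point p v = p * M + inv_into {..<M} dec v"

definition translate :: "(nat \<Rightarrow> nat) \<Rightarrow> nat \<Rightarrow> (nat \<Rightarrow> nat) \<Rightarrow> nat \<Rightarrow> nat" where
  "translate v m u = (\<lambda>i\<in>{..<r}. v i + m * u i)"

text \<open>Some planted direction joins the two vertices at the speed given by their parts. The
  subtraction is meaningful only when the part of \<open>x\<close> comes first.\<close>

definition aligned :: "nat \<Rightarrow> nat \<Rightarrow> bool" where
  "aligned x y \<longleftrightarrow> (\<exists>u\<in>S. vec y = translate (vec x) (part y - part x) u)"

text \<open>Aligned vertices in different parts follow the pattern, so every progression carries a
  copy. Between sensitive parts all other pairs do the opposite; between insensitive parts every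
  pair follows the pattern.\<close>

definition G :: "(nat \<times> nat) set" where
  "G = {(x, y) \<in> opairs (k * M). if part x = part y then c
     else f (part x) (part y) = (aligned x y \<or> \<not> t (part x) (part y))}"

definition aligned_triples :: "(nat \<times> nat \<times> nat) set" where
  "aligned_triples = {(x, y, z). x < k * M \<and> y < k * M \<and> z < k * M \<and>
     part x < part y \<and> part y < part z \<and> aligned x y \<and> aligned y z \<and> aligned x z}"

lemma M_pos: "0 < M"
  using k d by (simp add: M_def)

lemma dec_M: "bij_betw dec {..<M} (box r (k * d))"
  using dec by (simp add: M_def)

lemma point_part_vec: "point (part x) (vec x) = x"
  using bij_betw_inv_into_left[OF dec_M] M_pos by (simp add: point_def part_def vec_def)

lemma inv_dec_less: "v \<in> box r (k * d) \<Longrightarrow> inv_into {..<M} dec v < M"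
  using bij_betw_inv_into[OF dec_M] by (auto simp: bij_betw_def)

lemma part_point: "v \<in> box r (k * d) \<Longrightarrow> part (point p v) = p"
  using inv_dec_less M_pos by (simp add: part_def point_def)

lemma vec_point: "v \<in> box r (k * d) \<Longrightarrow> vec (point p v) = v"
  using inv_dec_less[of v] bij_betw_inv_into_right[OF dec_M] by (simp add: vec_def point_def)

lemma point_less: "p < k \<Longrightarrow> v \<in> box r (k * d) \<Longrightarrow> point p v < k * M"
proof -
  assume "p < k" "v \<in> box r (k * d)"
  then have "point p v < Suc p * M" "Suc p * M \<le> k * M"
    using inv_dec_less[of v] by (auto simp: point_def simp del: mult_Suc intro: mult_right_mono)
      (simp add: add.commute)
  then show ?thesis by linarith
qed

lemma part_less: "x < k * M \<Longrightarrow> part x < k"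
  by (simp add: part_def less_mult_imp_div_less)

lemma part_mono: "x \<le> y \<Longrightarrow> part x \<le> part y"
  by (simp add: part_def div_le_mono)

lemma finite_S: "finite S"
  using S finite_box by (rule finite_subset)

text \<open>The direction of the long step is a proper convex combination of the directions of the
  two short ones; all lie on the sphere, so strict convexity makes them equal.\<close>

lemma aligned_triple_same_direction:
  assumes uS: "u \<in> S" "v \<in> S" "w \<in> S" and p: "part x < part y" "part y < part z"
    and u: "vec y = translate (vec x) (part y - part x) u"
    and v: "vec z = translate (vec y) (part z - part y) v"
    and w: "vec z = translate (vec x) (part z - part x) w"
  shows "u = w"
proof -
  let ?a = "part y - part x" and ?b = "part z - part y"
  have ab: "part z - part x = ?a + ?b" using p by simp
  have eq: "?a * u i + ?b * v i = (?a + ?b) * w i" if "i < r" for i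
  proof -
    have "vec y i = vec x i + ?a * u i" "vec z i = vec y i + ?b * v i"
      "vec z i = vec x i + (?a + ?b) * w i"
      using fun_cong[OF u, of i] fun_cong[OF v, of i] fun_cong[OF w, of i] that
      by (simp_all add: ab translate_def)
    then show ?thesis by simp
  qed
  have uv: "u i = v i" if "i < r" for i
    using sphere_strictly_convex[OF sphere[OF uS(1)] sphere[OF uS(2)] sphere[OF uS(3)] _ _ eq that] p
    by simp
  show ?thesis
  proof (rule box_eqI[where r = r])
    show "u i = w i" if "i < r" for i
    proof -
      have "(?a + ?b) * u i = (?a + ?b) * w i"
        using eq[OF that] uv[OF that] by (simp add: add_mult_distrib)
      then show ?thesis using p by simp
    qed
  qed (use uS S in auto)
qed

text \<open>The first vertex, the common direction and the two later parts determine the triple, so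
  it has only two degrees of freedom of order \<open>k * M\<close>.\<close>

lemma card_aligned_triples: "card aligned_triples \<le> k\<^sup>2 * (k * M)\<^sup>2"
proof -
  let ?h = "\<lambda>(x, u, p, q). (x, point p (translate (vec x) (p - part x) u),
    point q (translate (vec x) (q - part x) u))"
  let ?D = "{..<k * M} \<times> S \<times> {..<k} \<times> {..<k}"
  have "aligned_triples \<subseteq> ?h ` ?D"
  proof
    fix T assume "T \<in> aligned_triples"
    then obtain x y z where T: "T = (x, y, z)" and less: "x < k * M" "y < k * M" "z < k * M"
      and p: "part x < part y" "part y < part z" and al: "aligned x y" "aligned y z" "aligned x z"
      by (auto simp: aligned_triples_def)
    obtain u v w where uvw: "u \<in> S" "v \<in> S" "w \<in> S"
      "vec y = translate (vec x) (part y - part x) u"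
      "vec z = translate (vec y) (part z - part y) v"
      "vec z = translate (vec x) (part z - part x) w"
      using al by (auto simp: aligned_def)
    have "u = w" by (rule aligned_triple_same_direction[OF uvw(1-3) p uvw(4-6)])
    then have "T = ?h (x, u, part y, part z)"
      using uvw(4,6) point_part_vec[of y] point_part_vec[of z] by (simp add: T)
    moreover have "(x, u, part y, part z) \<in> ?D" using less uvw(1) part_less by auto
    ultimately show "T \<in> ?h ` ?D" by blast
  qed
  then have "card aligned_triples \<le> card ?D"
    using finite_S by (intro surj_card_le) auto
  also have "\<dots> = k * M * (card S * (k * k))" by (simp add: card_cartesian_product)
  also have "card S \<le> k * M"
  proof -
    have "card S \<le> card (box r d)" by (rule card_mono[OF finite_box S])
    also have "\<dots> \<le> (k * d) ^ r" using k by (simp add: card_box power_mono)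
    also have "\<dots> \<le> k * M" using k by (simp add: M_def)
    finally show ?thesis .
  qed
  finally show ?thesis by (simp add: power2_eq_square mult.assoc mult.commute mult.left_commute)
qed

text \<open>The parts of the embedded vertices form a map to which rigidity applies; a sensitive
  pair that follows the pattern must be aligned.\<close>

lemma embedding_contains_aligned_triple:
  assumes "pattern_embedding k f (k * M) G \<phi>"
  shows "\<exists>a b e. a < b \<and> b < e \<and> e < k \<and> (\<phi> a, \<phi> b, \<phi> e) \<in> aligned_triples"
proof -
  have lt: "\<phi> i < k * M" if "i < k" for i using assms that by (simp add: pattern_embedding_def)
  have emb: "\<phi> i < \<phi> j" "(\<phi> i, \<phi> j) \<in> G \<longleftrightarrow> f i j" if "i < j" "j < k" for i j
    using assms that by (auto simp: pattern_embedding_def)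
  let ?\<psi> = "\<lambda>i. part (\<phi> i)"
  have same: "f i j = c" if "i < j" "j < k" "?\<psi> i = ?\<psi> j" for i j
    using emb[OF that(1,2)] lt[OF that(2)] that(3) by (auto simp: G_def opairs_def)
  have diff: "f i j \<longleftrightarrow> f (?\<psi> i) (?\<psi> j) = (aligned (\<phi> i) (\<phi> j) \<or> \<not> t (?\<psi> i) (?\<psi> j))"
    if "i < j" "j < k" "?\<psi> i \<noteq> ?\<psi> j" for i j
    using emb[OF that(1,2)] lt[OF that(2)] that(3) by (auto simp: G_def opairs_def)
  have "?\<psi> i \<le> ?\<psi> j \<and>
      (if ?\<psi> i = ?\<psi> j then f i j = c else f i j = f (?\<psi> i) (?\<psi> j) \<or> t (?\<psi> i) (?\<psi> j))"
    if "i < j" "j < k" for i j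
    using same[OF that] diff[OF that] part_mono[OF less_imp_le[OF emb(1)[OF that]]] by auto
  moreover have "?\<psi> i < k" if "i < k" for i using part_less[OF lt[OF that]] .
  ultimately obtain a b e where abe: "a < b" "b < e" "e < k" "?\<psi> a < ?\<psi> b" "?\<psi> b < ?\<psi> e"
    and tight: "\<forall>(i, j) \<in> {(a, b), (b, e), (a, e)}. t (?\<psi> i) (?\<psi> j) \<and> f i j = f (?\<psi> i) (?\<psi> j)"
    using rigid[unfolded rigid_pattern_def, rule_format, of ?\<psi>] by blast
  have "aligned (\<phi> a) (\<phi> b)" using diff[of a b] abe tight by auto
  moreover have "aligned (\<phi> b) (\<phi> e)" using diff[of b e] abe tight by auto
  moreover have "aligned (\<phi> a) (\<phi> e)" using diff[of a e] abe tight by auto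
  ultimately have "(\<phi> a, \<phi> b, \<phi> e) \<in> aligned_triples"
    using abe lt[of a] lt[of b] lt[of e] by (simp add: aligned_triples_def)
  then show ?thesis using abe by blast
qed

text \<open>Each copy is an aligned triple together with \<open>k - 3\<close> further vertices,
  which saves one factor \<open>k * M\<close> over the trivial bound.\<close>

lemma card_copies: "card (pattern_copies k f (k * M) G) \<le> k\<^sup>2 * (k * M) ^ (k - 1)"
proof -
  let ?n = "k * M"
  let ?Y = "{Y. Y \<subseteq> {..<?n} \<and> card Y = k - 3}"
  have finY: "finite ?Y" by (rule finite_subset[of _ "Pow {..<?n}"]) auto
  have finT: "finite aligned_triples"
    by (rule finite_subset[of _ "{..<?n} \<times> {..<?n} \<times> {..<?n}"]) (auto simp: aligned_triples_def)
  have "pattern_copies k f ?n G \<subseteq> (\<lambda>((x, y, z), Y). {x, y, z} \<union> Y) ` (aligned_triples \<times> ?Y)"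
  proof
    fix X assume "X \<in> pattern_copies k f ?n G"
    then obtain \<phi> where X: "X = \<phi> ` {..<k}" and \<phi>: "pattern_embedding k f ?n G \<phi>"
      by (auto simp: pattern_copies_def)
    obtain a b e where abe: "a < b" "b < e" "e < k" "(\<phi> a, \<phi> b, \<phi> e) \<in> aligned_triples"
      using embedding_contains_aligned_triple[OF \<phi>] by blast
    have lt: "\<phi> i < \<phi> j" if "i < j" "j < k" for i j using \<phi> that by (simp add: pattern_embedding_def)
    have "inj_on \<phi> {..<k}"
      by (rule inj_onI) (metis lt lessThan_iff less_irrefl linorder_neqE_nat)
    then have cX: "card X = k" by (simp add: X card_image)
    have sub: "{\<phi> a, \<phi> b, \<phi> e} \<subseteq> X" using abe by (auto simp: X)
    have "card {\<phi> a, \<phi> b, \<phi> e} = 3" using lt[of a b] lt[of b e] lt[of a e] abe by simp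
    then have "card (X - {\<phi> a, \<phi> b, \<phi> e}) = k - 3"
      using cX card_Diff_subset[OF _ sub] by simp
    moreover have "X \<subseteq> {..<?n}" using \<phi> by (auto simp: X pattern_embedding_def)
    ultimately have "X - {\<phi> a, \<phi> b, \<phi> e} \<in> ?Y" by blast
    moreover have "X = {\<phi> a, \<phi> b, \<phi> e} \<union> (X - {\<phi> a, \<phi> b, \<phi> e})" using sub by blast
    ultimately show "X \<in> (\<lambda>((x, y, z), Y). {x, y, z} \<union> Y) ` (aligned_triples \<times> ?Y)"
      using abe(4) by (intro image_eqI[of _ _ "((\<phi> a, \<phi> b, \<phi> e), X - {\<phi> a, \<phi> b, \<phi> e})"]) auto
  qed
  then have "card (pattern_copies k f ?n G) \<le> card (aligned_triples \<times> ?Y)"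
    using finY finT by (intro surj_card_le) auto
  also have "\<dots> = card aligned_triples * (?n choose (k - 3))"
    by (simp add: card_cartesian_product n_subsets)
  also have "\<dots> \<le> (k\<^sup>2 * ?n\<^sup>2) * ?n ^ (k - 3)"
  proof (intro mult_le_mono card_aligned_triples binomial_le_pow)
    have "k * 1 \<le> k * M" using M_pos by (intro mult_le_mono) auto
    then show "k - 3 \<le> k * M" by linarith
  qed
  also have "\<dots> = k\<^sup>2 * ?n ^ (2 + (k - 3))" by (simp only: power_add mult.assoc)
  also have "2 + (k - 3) = k - 1" using k by simp
  finally show ?thesis .
qed

lemma translate_box:
  assumes v: "v \<in> box r d" and u: "u \<in> S" and m: "m < k"
  shows "translate v m u \<in> box r (k * d)"
proof -
  have "v i + m * u i < k * d" if "i < r" for i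
  proof -
    have "v i < d" "u i < d" using v u S that by (auto simp: box_def PiE_def Pi_def)
    then have "v i + m * u i < d + m * d" by (intro add_less_le_mono) auto
    also have "d + m * d = Suc m * d" by simp
    also have "\<dots> \<le> k * d" using m by (intro mult_right_mono) auto
    finally show ?thesis .
  qed
  then show ?thesis by (simp add: translate_def box_def)
qed

text \<open>Every progression, given by a start \<open>v\<close> and a direction \<open>u\<close>,
  carries a planted copy, so an edit must change one of its pairs. Two points of a progression in
  known parts determine it, so these changes are distinct.\<close>

lemma far:
  assumes G': "G' \<subseteq> opairs (k * M)" and free: "\<nexists>\<phi>. pattern_embedding k f (k * M) G' \<phi>"
  shows "d ^ r * card S \<le> card (sym_diff G G')"
proof -
  define U where "U v u j = point j (translate v j u)" for v u j
  have ex: "\<exists>i j. i < j \<and> j < k \<and> (U v u i, U v u j) \<in> sym_diff G G'"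
    if vu: "v \<in> box r d" "u \<in> S" for v u
  proof (rule ccontr)
    assume no: "\<not> ?thesis"
    have box: "translate v j u \<in> box r (k * d)" if "j < k" for j
      by (rule translate_box[OF vu that])
    have p: "part (U v u j) = j" "vec (U v u j) = translate v j u" "U v u j < k * M" if "j < k" for j
      using box[OF that] part_point vec_point point_less[OF that] by (auto simp: U_def)
    have "U v u i < U v u j \<and> ((U v u i, U v u j) \<in> G' \<longleftrightarrow> f i j)" if ij: "i < j" "j < k" for i j
    proof -
      have i: "i < k" using ij by simp
      have lt: "U v u i < U v u j"
        using part_mono[of "U v u j" "U v u i"] p(1)[OF i] p(1)[OF ij(2)] ij by linarith
      have "translate v j u = translate (translate v i u) (j - i) u"
        using ij by (auto simp: translate_def fun_eq_iff add.assoc add_mult_distrib[symmetric])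
      then have "aligned (U v u i) (U v u j)"
        using vu p(1,2)[OF i] p(1,2)[OF ij(2)] by (auto simp: aligned_def)
      then have "(U v u i, U v u j) \<in> G \<longleftrightarrow> f i j"
        using lt p(1)[OF i] p(1,3)[OF ij(2)] ij by (auto simp: G_def opairs_def)
      then show ?thesis using no ij lt by blast
    qed
    then have "pattern_embedding k f (k * M) G' (U v u)"
      using p(3) by (simp add: pattern_embedding_def)
    then show False using free by blast
  qed
  \<comment> \<open>One edited pair is chosen in each planted copy; \<open>H\<close> below sends the
    copy to it.\<close>
  define I where "I v u = (SOME (i, j). i < j \<and> j < k \<and> (U v u i, U v u j) \<in> sym_diff G G')" for v u
  have I: "\<exists>i j. I v u = (i, j) \<and> i < j \<and> j < k \<and> (U v u i, U v u j) \<in> sym_diff G G'"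
    if vu: "v \<in> box r d" "u \<in> S" for v u
  proof -
    have "case I v u of (i, j) \<Rightarrow> i < j \<and> j < k \<and> (U v u i, U v u j) \<in> sym_diff G G'"
      unfolding I_def by (rule someI_ex) (use ex[OF vu] in auto)
    then show ?thesis by (cases "I v u") simp
  qed
  define H where "H = (\<lambda>(v, u). (U v u (fst (I v u)), U v u (snd (I v u))))"
  have "inj_on H (box r d \<times> S)"
  proof (rule inj_onI)
    fix P P' assume P: "P \<in> box r d \<times> S" "P' \<in> box r d \<times> S" and eq: "H P = H P'"
    obtain v u v' u' where vu: "P = (v, u)" "P' = (v', u')" "v \<in> box r d" "u \<in> S" "v' \<in> box r d" "u' \<in> S"
      using P by auto
    obtain i j where ij: "I v u = (i, j)" "i < j" "j < k" using I[OF vu(3,4)] by blast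
    obtain i' j' where ij': "I v' u' = (i', j')" "i' < j'" "j' < k" using I[OF vu(5,6)] by blast
    have p: "part (U v u m) = m" "vec (U v u m) = translate v m u" if "m < k" for m
      using translate_box[OF vu(3,4) that] part_point vec_point by (auto simp: U_def)
    have p': "part (U v' u' m) = m" "vec (U v' u' m) = translate v' m u'" if "m < k" for m
      using translate_box[OF vu(5,6) that] part_point vec_point by (auto simp: U_def)
    have U: "U v u i = U v' u' i'" "U v u j = U v' u' j'" using eq vu ij ij' by (auto simp: H_def)
    have ii: "i' = i" "j' = j" using U p(1) p'(1) ij ij' by (metis less_trans)+
    have tr: "translate v i u = translate v' i u'" "translate v j u = translate v' j u'"
      using U ii p(2) p'(2) ij by (metis less_trans)+
    have "v l = v' l \<and> u l = u' l" if "l < r" for l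
    proof -
      have 1: "v l + i * u l = v' l + i * u' l" "v l + j * u l = v' l + j * u' l"
        using fun_cong[OF tr(1), of l] fun_cong[OF tr(2), of l] that by (auto simp: translate_def)
      \<comment> \<open>Subtracting the two position equations isolates the direction, as
        \<open>i\<close> and \<open>j\<close> differ.\<close>
      have "(int j - int i) * (int (u l) - int (u' l)) = 0"
        using 1[THEN arg_cong[where f = int]] by (simp add: algebra_simps)
      then have "u l = u' l" using ij by simp
      then show ?thesis using 1 by simp
    qed
    then show "P = P'" using vu S box_eqI by (metis subsetD)
  qed
  moreover have "H ` (box r d \<times> S) \<subseteq> sym_diff G G'"
  proof
    fix e assume "e \<in> H ` (box r d \<times> S)"
    then obtain v u where "v \<in> box r d" "u \<in> S" "e = H (v, u)" by auto
    then show "e \<in> sym_diff G G'" using I[of v u] by (auto simp: H_def)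
  qed
  moreover have "finite (sym_diff G G')"
    by (rule finite_subset[OF _ finite_opairs[of "k * M"]]) (use G' in \<open>auto simp: G_def\<close>)
  ultimately have "card (box r d \<times> S) \<le> card (sym_diff G G')"
    by (intro card_inj_on_le)
  then show ?thesis by (simp add: card_cartesian_product card_box)
qed

end

section \<open>Failure of polynomial bounds\<close>

text \<open>The large sphere gives at least \<open>d^(2*r) / (r * d^2)\<close> planted copies,
  whereas \<open>n^2 = k^(2*r+2) * d^(2*r)\<close>; the quotient is the distance parameter.\<close>

lemma rigid_pattern_hard_graph:
  fixes r d :: nat
  assumes rigid: "rigid_pattern k f c t" and k: "3 \<le> k" and r: "0 < r" and d: "0 < d"
  defines "n \<equiv> k * (k * d) ^ r"
  shows "\<exists>A \<subseteq> opairs n. far_from_pattern_free (1 / (r * d\<^sup>2 * k ^ (2 * r + 2))) k f n A \<and>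
    card (pattern_copies k f n A) \<le> k\<^sup>2 * n ^ (k - 1)"
proof -
  obtain S s where S: "S \<subseteq> box r d" "\<And>v. v \<in> S \<Longrightarrow> (\<Sum>i<r. (v i)\<^sup>2) = s" "d ^ r \<le> r * d\<^sup>2 * card S"
    using ex_large_sphere[OF r d] by blast
  obtain dec where dec: "bij_betw dec {..<(k * d) ^ r} (box r (k * d))"
    using ex_bij_betw_nat_finite[OF finite_box, of r "k * d"] by (auto simp: card_box atLeast0LessThan)
  note S_large = S(3)
  with dec interpret sphere_blowup k r d S s dec f t c
    using assms S by unfold_locales auto
  have n: "n = k * M" by (simp add: n_def M_def)
  have "far_from_pattern_free (1 / (r * d\<^sup>2 * k ^ (2 * r + 2))) k f n G"
    unfolding far_from_pattern_free_def
  proof (intro allI impI)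
    fix A' assume "A' \<subseteq> opairs n" "\<nexists>\<phi>. pattern_embedding k f n A' \<phi>"
    then have "d ^ r * card S \<le> card (sym_diff G A')" using far n by simp
    then have le: "real (d ^ r * card S) \<le> card (sym_diff G A')" by (rule of_nat_mono)
    have "(real n)\<^sup>2 = real k ^ (2 * r + 2) * (real d ^ r * real d ^ r)"
      by (simp add: n_def power_mult_distrib power_add power_mult power2_eq_square mult_ac)
    then have "1 / (r * d\<^sup>2 * k ^ (2 * r + 2)) * (real n)\<^sup>2 = real d ^ r * real d ^ r / (r * d\<^sup>2)"
      using k by simp
    also have "\<dots> \<le> real d ^ r * card S"
    proof -
      have "real (d ^ r) \<le> real (r * d\<^sup>2 * card S)" using S_large by (rule of_nat_mono)
      then have "real d ^ r / (r * d\<^sup>2) \<le> card S" using r d by (simp add: field_simps)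
      then have "real d ^ r * (real d ^ r / (r * d\<^sup>2)) \<le> real d ^ r * card S" by (intro mult_left_mono) auto
      then show ?thesis by simp
    qed
    finally show "1 / (r * d\<^sup>2 * k ^ (2 * r + 2)) * (real n)\<^sup>2 \<le> card (sym_diff G A')"
      using le by simp
  qed
  moreover have "G \<subseteq> opairs n" by (auto simp: G_def n)
  ultimately show ?thesis using card_copies n by metis
qed

text \<open>For fixed dimension \<open>r\<close>, \<epsilon> is of order \<open>d^(-2)\<close> while
  the density of copies is at most \<open>k^2 / n\<close> and \<open>n\<close> is at least
  \<open>d^r\<close>. Once \<open>r\<close> exceeds \<open>2 * C\<close>, large \<open>d\<close>
  contradicts a bound with exponent \<open>C\<close>.\<close>

theorem rigid_pattern_not_polynomial:
  assumes rigid: "rigid_pattern k f c t" and k: "3 \<le> k"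
  shows "\<not> polynomial_pattern_removal k f"
proof
  assume "polynomial_pattern_removal k f"
  then obtain c0 C :: real where c0: "0 < c0" "0 < C"
    and removal: "\<And>\<epsilon> n A. 0 < \<epsilon> \<Longrightarrow> \<epsilon> < 1 \<Longrightarrow> A \<subseteq> opairs n \<Longrightarrow> far_from_pattern_free \<epsilon> k f n A \<Longrightarrow>
      c0 * \<epsilon> powr C * real n ^ k \<le> card (pattern_copies k f n A)"
    unfolding polynomial_pattern_removal_def by metis
  \<comment> \<open>This leaves a spare factor \<open>d\<close> over
    \<open>d powr (2 * C)\<close>.\<close>
  define r where "r = nat \<lceil>2 * C\<rceil> + 1"
  have r: "0 < r" "2 * C + 1 \<le> r" by (auto simp: r_def) linarith
  define K where "K = real r * real k ^ (2 * r + 2)"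
  have K: "1 < K"
  proof -
    have "1 * 1 < real r * real k ^ (2 * r + 2)"
      using r(1) k by (intro mult_le_less_imp_less one_less_power) auto
    then show ?thesis by (simp add: K_def)
  qed
  have bound: "c0 * K powr (- C) * d \<le> (real k)\<^sup>2" if d: "0 < d" for d :: nat
  proof -
    define n where "n = k * (k * d) ^ r"
    define \<epsilon> where "\<epsilon> = 1 / (r * d\<^sup>2 * k ^ (2 * r + 2))"
    obtain A where A: "A \<subseteq> opairs n" "far_from_pattern_free \<epsilon> k f n A"
      "card (pattern_copies k f n A) \<le> k\<^sup>2 * n ^ (k - 1)"
      using rigid_pattern_hard_graph[OF rigid k r(1) d] unfolding n_def \<epsilon>_def by blast
    have \<epsilon>: "\<epsilon> = 1 / (K * (real d)\<^sup>2)" by (simp add: \<epsilon>_def K_def mult_ac)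
    have Kd: "1 < K * (real d)\<^sup>2"
    proof -
      have "1 \<le> (real d)\<^sup>2" using d by (simp add: Suc_le_eq)
      then show ?thesis using K by (metis less_1_mult mult.right_neutral order_less_le)
    qed
    have n0: "0 < n" using k d by (simp add: n_def)
    have "c0 * \<epsilon> powr C * real n ^ k \<le> card (pattern_copies k f n A)"
      by (rule removal[OF _ _ A(1,2)]) (use Kd \<epsilon> in auto)
    also have "\<dots> \<le> real (k\<^sup>2 * n ^ (k - 1))" by (rule of_nat_mono[OF A(3)])
    also have "\<dots> = (real k)\<^sup>2 * real n ^ (k - 1)" by simp
    finally have "c0 * \<epsilon> powr C * real n * real n ^ (k - 1) \<le> (real k)\<^sup>2 * real n ^ (k - 1)"
      using k power_Suc[of "real n" "k - 1"] by (simp add: mult.assoc)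
    then have 1: "c0 * \<epsilon> powr C * real n \<le> (real k)\<^sup>2"
      using n0 by (simp add: mult_le_cancel_right)
    have "\<epsilon> powr C = K powr (- C) * real d powr (- (2 * C))"
      using K d by (simp add: \<epsilon> powr_divide powr_mult powr_minus_divide powr_powr flip: powr_numeral)
    moreover have "real d powr (2 * C + 1) \<le> real n"
    proof -
      have "real d powr (2 * C + 1) \<le> real d powr r"
        using d r(2) by (intro powr_mono) auto
      also have "\<dots> = real (d ^ r)" using d by (simp add: powr_realpow)
      also have "d ^ r \<le> n"
      proof -
        have "d ^ r \<le> (k * d) ^ r" using k by (intro power_mono) auto
        also have "\<dots> \<le> n" using k by (simp add: n_def)
        finally show ?thesis .
      qed
      finally show ?thesis by simp
    qed
    then have "real d powr (- (2 * C)) * real d powr (2 * C + 1) \<le> real d powr (- (2 * C)) * real n"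
      by (intro mult_left_mono) auto
    then have "real d \<le> real d powr (- (2 * C)) * real n"
      using d by (simp flip: powr_add)
    then have "c0 * K powr (- C) * real d \<le> c0 * K powr (- C) * (real d powr (- (2 * C)) * real n)"
      using c0 by (intro mult_left_mono) auto
    ultimately show ?thesis using 1 by (simp add: mult.assoc)
  qed
  have E: "0 < c0 * K powr (- C)" using c0 K by simp
  obtain d :: nat where "(real k)\<^sup>2 / (c0 * K powr (- C)) < d" using reals_Archimedean2 by blast
  then have "(real k)\<^sup>2 < c0 * K powr (- C) * d" using E by (simp add: field_simps)
  moreover have "0 < d"
    using calculation by (cases d) auto
  ultimately show False using bound[of d] by simp
qed

section \<open>Rigid patterns\<close>

lemma rigid_patternI:
  assumes "\<And>\<psi>. (\<And>i. i < k \<Longrightarrow> \<psi> i < k) \<Longrightarrow> (\<And>i j. i < j \<Longrightarrow> j < k \<Longrightarrow> \<psi> i \<le> \<psi> j) \<Longrightarrow>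
      (\<And>i j. i < j \<Longrightarrow> j < k \<Longrightarrow> \<psi> i = \<psi> j \<Longrightarrow> f i j = c) \<Longrightarrow>
      (\<And>i j. i < j \<Longrightarrow> j < k \<Longrightarrow> \<psi> i \<noteq> \<psi> j \<Longrightarrow> f i j = f (\<psi> i) (\<psi> j) \<or> t (\<psi> i) (\<psi> j)) \<Longrightarrow>
      \<exists>a b d. a < b \<and> b < d \<and> d < k \<and> \<psi> a < \<psi> b \<and> \<psi> b < \<psi> d \<and>
        (\<forall>(i, j) \<in> {(a, b), (b, d), (a, d)}. t (\<psi> i) (\<psi> j) \<and> f i j = f (\<psi> i) (\<psi> j))"
  shows "rigid_pattern k f c t"
  unfolding rigid_pattern_def
proof (intro allI impI)
  fix \<psi> :: "nat \<Rightarrow> nat"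
  assume 1: "\<forall>i<k. \<psi> i < k"
    and 2: "\<forall>i j. i < j \<longrightarrow> j < k \<longrightarrow> \<psi> i \<le> \<psi> j \<and>
        (if \<psi> i = \<psi> j then f i j = c else f i j = f (\<psi> i) (\<psi> j) \<or> t (\<psi> i) (\<psi> j))"
  show "\<exists>a b d. a < b \<and> b < d \<and> d < k \<and> \<psi> a < \<psi> b \<and> \<psi> b < \<psi> d \<and>
        (\<forall>(i, j) \<in> {(a, b), (b, d), (a, d)}. t (\<psi> i) (\<psi> j) \<and> f i j = f (\<psi> i) (\<psi> j))"
    by (rule assms) (use 1 2 in \<open>meson | presburger\<close>)+
qed

text \<open>A pair of colour \<open>g\<close> can map neither into one part nor to parts of the
  other colour, where the pattern must be followed. So the homogeneous triple maps to a homogeneous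
  triple of sensitive parts.\<close>

lemma rigid_pattern_homogeneous:
  assumes "a < b" "b < d" "d < k" and "f a b = g" "f b d = g" "f a d = g"
  shows "rigid_pattern k f (\<not> g) (\<lambda>i j. f i j = g)"
proof (rule rigid_patternI)
  fix \<psi> :: "nat \<Rightarrow> nat"
  assume mono: "\<And>i j. i < j \<Longrightarrow> j < k \<Longrightarrow> \<psi> i \<le> \<psi> j"
    and same: "\<And>i j. i < j \<Longrightarrow> j < k \<Longrightarrow> \<psi> i = \<psi> j \<Longrightarrow> f i j = (\<not> g)"
    and diff: "\<And>i j. i < j \<Longrightarrow> j < k \<Longrightarrow> \<psi> i \<noteq> \<psi> j \<Longrightarrow> f i j = f (\<psi> i) (\<psi> j) \<or> f (\<psi> i) (\<psi> j) = g"
  have *: "\<psi> i < \<psi> j \<and> f (\<psi> i) (\<psi> j) = g" if "i < j" "j < k" "f i j = g" for i j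
    using mono[OF that(1,2)] same[OF that(1,2)] diff[OF that(1,2)] that(3) by (auto simp: le_less)
  show "\<exists>a b d. a < b \<and> b < d \<and> d < k \<and> \<psi> a < \<psi> b \<and> \<psi> b < \<psi> d \<and>
      (\<forall>(i, j) \<in> {(a, b), (b, d), (a, d)}. f (\<psi> i) (\<psi> j) = g \<and> f i j = f (\<psi> i) (\<psi> j))"
    using assms *[of a b] *[of b d] *[of a d]
    by (intro exI[of _ a] exI[of _ b] exI[of _ d]) simp
qed

text \<open>Consecutive vertices cannot share a part of inner colour \<open>\<not> g\<close>, so
  \<psi> is strictly increasing, hence the identity.\<close>

lemma rigid_pattern_consecutive:
  assumes k: "3 \<le> k" and cons: "\<And>i. Suc i < k \<Longrightarrow> f i (Suc i) = g"
  shows "rigid_pattern k f (\<not> g) (\<lambda>_ _. True)"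
proof (rule rigid_patternI)
  fix \<psi> :: "nat \<Rightarrow> nat"
  assume range: "\<And>i. i < k \<Longrightarrow> \<psi> i < k"
    and mono: "\<And>i j. i < j \<Longrightarrow> j < k \<Longrightarrow> \<psi> i \<le> \<psi> j"
    and same: "\<And>i j. i < j \<Longrightarrow> j < k \<Longrightarrow> \<psi> i = \<psi> j \<Longrightarrow> f i j = (\<not> g)"
  have step: "\<psi> i < \<psi> (Suc i)" if "Suc i < k" for i
    using mono[of i "Suc i"] same[of i "Suc i"] cons[of i] that by fastforce
  have up: "i + \<psi> j \<le> \<psi> (i + j)" if "i + j < k" for i j
    using that
  proof (induction i)
    case (Suc i)
    then show ?case using step[of "i + j"] by simp
  qed simp
  have id: "\<psi> i = i" if "i < k" for i
    using up[of i 0] up[of "k - 1 - i" i] range[of "k - 1"] that by simp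
  show "\<exists>a b d. a < b \<and> b < d \<and> d < k \<and> \<psi> a < \<psi> b \<and> \<psi> b < \<psi> d \<and>
      (\<forall>(i, j) \<in> {(a, b), (b, d), (a, d)}. True \<and> f i j = f (\<psi> i) (\<psi> j))"
    using k id[of 0] id[of 1] id[of 2]
    by (intro exI[of _ 0] exI[of _ 1] exI[of _ 2]) simp
qed

text \<open>The Ramsey bound R(3,3) \<le> 6; the twenty triples give an unsatisfiable propositional
  problem.\<close>

lemma ramsey_3_3:
  fixes f :: "nat \<Rightarrow> nat \<Rightarrow> bool"
  shows "\<exists>a b d. a < b \<and> b < d \<and> d < 6 \<and> f a b = f b d \<and> f a d = f b d"
proof (rule ccontr)
  assume "\<not> ?thesis"
  then have no: "\<not> (f a b = f b d \<and> f a d = f b d)" if "a < b" "b < d" "d < 6" for a b d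
    using that by blast
  show False
    using no[of 0 1 2] no[of 0 1 3] no[of 0 1 4] no[of 0 1 5] no[of 0 2 3] no[of 0 2 4] no[of 0 2 5]
      no[of 0 3 4] no[of 0 3 5] no[of 0 4 5] no[of 1 2 3] no[of 1 2 4] no[of 1 2 5] no[of 1 3 4]
      no[of 1 3 5] no[of 1 4 5] no[of 2 3 4] no[of 2 3 5] no[of 2 4 5] no[of 3 4 5]
    by (simp only: numeral_less_iff) (simp, argo)
qed

section \<open>Patterns on four and five vertices by computation\<close>

text \<open>The search space for \<psi>, which is weakly increasing in every case that rigidity has
  to consider.\<close>

fun mono_lists :: "nat \<Rightarrow> nat \<Rightarrow> nat list list" where
  "mono_lists 0 m = [[]]"
| "mono_lists (Suc n) m = [p @ [x]. x \<leftarrow> [0..<m], p \<leftarrow> mono_lists n (Suc x)]"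

lemma map_mono_lists:
  assumes "\<And>i j. i < j \<Longrightarrow> j < n \<Longrightarrow> \<psi> i \<le> \<psi> j" and "\<And>i. i < n \<Longrightarrow> \<psi> i < m"
  shows "map \<psi> [0..<n] \<in> set (mono_lists n m)"
  using assms
proof (induction n arbitrary: m)
  case (Suc n)
  have "map \<psi> [0..<n] \<in> set (mono_lists n (Suc (\<psi> n)))"
    using Suc.prems by (intro Suc.IH) (auto simp: less_Suc_eq_le)
  then show ?case using Suc.prems(2)[of n] by auto
qed simp

definition pair_list :: "nat \<Rightarrow> (nat \<times> nat) list" where
  "pair_list k = [(i, j). j \<leftarrow> [0..<k], i \<leftarrow> [0..<j]]"

definition triple_list :: "nat \<Rightarrow> (nat \<times> nat \<times> nat) list" where
  "triple_list k = [(a, b, d). d \<leftarrow> [0..<k], b \<leftarrow> [0..<d], a \<leftarrow> [0..<b]]"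

text \<open>A pattern as a truth table along \<open>pair_list\<close>, so that running through bit
  lists runs through all patterns on \<open>k\<close> vertices.\<close>

definition tabulated :: "nat \<Rightarrow> bool list \<Rightarrow> nat \<Rightarrow> nat \<Rightarrow> bool" where
  "tabulated k bs i j \<longleftrightarrow> map_of (zip (pair_list k) bs) (i, j) = Some True"

definition rigid_check ::
    "nat \<Rightarrow> (nat \<Rightarrow> nat \<Rightarrow> bool) \<Rightarrow> bool \<Rightarrow> (nat \<Rightarrow> nat \<Rightarrow> bool) \<Rightarrow> nat list \<Rightarrow> bool" where
  "rigid_check k f c t p \<longleftrightarrow>
     list_all (\<lambda>(i, j). p ! i \<le> p ! j \<and> (if p ! i = p ! j then f i j = c
       else f i j = f (p ! i) (p ! j) \<or> t (p ! i) (p ! j))) (pair_list k) \<longrightarrow>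
     list_ex (\<lambda>(a, b, d). p ! a < p ! b \<and> p ! b < p ! d \<and>
       list_all (\<lambda>(i, j). t (p ! i) (p ! j) \<and> f i j = f (p ! i) (p ! j)) [(a, b), (b, d), (a, d)])
       (triple_list k)"

lemma set_pair_list: "set (pair_list k) = {(i, j). i < j \<and> j < k}"
  by (auto simp: pair_list_def)

lemma set_triple_list: "set (triple_list k) = {(a, b, d). a < b \<and> b < d \<and> d < k}"
  by (force simp: triple_list_def)

lemma rigid_pattern_by_check:
  assumes "\<forall>p \<in> set (mono_lists k k). rigid_check k f c t p"
  shows "rigid_pattern k f c t"
proof (rule rigid_patternI)
  fix \<psi> :: "nat \<Rightarrow> nat"
  assume range: "\<And>i. i < k \<Longrightarrow> \<psi> i < k"
    and mono: "\<And>i j. i < j \<Longrightarrow> j < k \<Longrightarrow> \<psi> i \<le> \<psi> j"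
    and same: "\<And>i j. i < j \<Longrightarrow> j < k \<Longrightarrow> \<psi> i = \<psi> j \<Longrightarrow> f i j = c"
    and diff: "\<And>i j. i < j \<Longrightarrow> j < k \<Longrightarrow> \<psi> i \<noteq> \<psi> j \<Longrightarrow> f i j = f (\<psi> i) (\<psi> j) \<or> t (\<psi> i) (\<psi> j)"
  let ?p = "map \<psi> [0..<k]"
  have p: "?p ! i = \<psi> i" if "i < k" for i using that by simp
  have "?p \<in> set (mono_lists k k)" using mono range by (rule map_mono_lists)
  then have "rigid_check k f c t ?p" using assms by blast
  moreover have "list_all (\<lambda>(i, j). ?p ! i \<le> ?p ! j \<and> (if ?p ! i = ?p ! j then f i j = c
       else f i j = f (?p ! i) (?p ! j) \<or> t (?p ! i) (?p ! j))) (pair_list k)"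
    using mono same diff by (auto simp: list_all_iff set_pair_list)
  ultimately obtain a b d where "a < b" "b < d" "d < k" "?p ! a < ?p ! b" "?p ! b < ?p ! d"
    "\<forall>(i, j) \<in> {(a, b), (b, d), (a, d)}. t (?p ! i) (?p ! j) \<and> f i j = f (?p ! i) (?p ! j)"
    unfolding rigid_check_def by (auto simp: list_ex_iff set_triple_list)
  then show "\<exists>a b d. a < b \<and> b < d \<and> d < k \<and> \<psi> a < \<psi> b \<and> \<psi> b < \<psi> d \<and>
        (\<forall>(i, j) \<in> {(a, b), (b, d), (a, d)}. t (\<psi> i) (\<psi> j) \<and> f i j = f (\<psi> i) (\<psi> j))"
    by (intro exI[of _ a] exI[of _ b] exI[of _ d]) simp
qed

text \<open>The first two alternatives are those settled by \<open>rigid_pattern_homogeneous\<close>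
  and \<open>rigid_pattern_consecutive\<close>; the third tries the candidate sets of sensitive
  pairs in \<open>ts\<close>.\<close>

definition pattern_check :: "nat \<Rightarrow> (nat \<times> nat) set list \<Rightarrow> bool list \<Rightarrow> bool" where
  "pattern_check k ts bs \<longleftrightarrow>
     (let f = tabulated k bs in
        list_ex (\<lambda>(a, b, d). f a b = f b d \<and> f a d = f b d) (triple_list k) \<or>
        list_all (\<lambda>i. f i (Suc i) = f 0 1) [0..<k - 1] \<or>
        list_ex (\<lambda>t. list_all (rigid_check k f (\<not> f 0 1) (\<lambda>i j. (i, j) \<in> t)) (mono_lists k k)) ts)"

text \<open>The candidates for the set of sensitive pairs of parts were found by exhaustive search.\<close>

lemma pattern_check_4:
  "list_all (pattern_check 4 [{(0, 1), (0, 3), (1, 3)}, {(0, 1), (0, 2), (0, 3), (1, 3), (2, 3)}])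
    (List.n_lists 6 [True, False])"
  by code_simp

lemma pattern_check_5:
  "list_all (pattern_check 5 [{(0, 1), (0, 3), (1, 3)}]) (List.n_lists 10 [True, False])"
  by code_simp

text \<open>As \<psi> is weakly increasing, the pattern is read only at increasing pairs also after
  applying \<psi>.\<close>

lemma rigid_pattern_cong:
  assumes eq: "\<And>i j. i < j \<Longrightarrow> j < k \<Longrightarrow> f i j = f' i j" and rigid: "rigid_pattern k f' c t"
  shows "rigid_pattern k f c t"
proof (rule rigid_patternI)
  fix \<psi> :: "nat \<Rightarrow> nat"
  assume range: "\<And>i. i < k \<Longrightarrow> \<psi> i < k"
    and mono: "\<And>i j. i < j \<Longrightarrow> j < k \<Longrightarrow> \<psi> i \<le> \<psi> j"
    and same: "\<And>i j. i < j \<Longrightarrow> j < k \<Longrightarrow> \<psi> i = \<psi> j \<Longrightarrow> f i j = c"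
    and diff: "\<And>i j. i < j \<Longrightarrow> j < k \<Longrightarrow> \<psi> i \<noteq> \<psi> j \<Longrightarrow> f i j = f (\<psi> i) (\<psi> j) \<or> t (\<psi> i) (\<psi> j)"
  have eq': "f (\<psi> i) (\<psi> j) = f' (\<psi> i) (\<psi> j)" if "i < j" "j < k" "\<psi> i \<noteq> \<psi> j" for i j
    using eq[of "\<psi> i" "\<psi> j"] mono[OF that(1,2)] range[OF that(2)] that(3) by simp
  have "\<psi> i \<le> \<psi> j \<and>
      (if \<psi> i = \<psi> j then f' i j = c else f' i j = f' (\<psi> i) (\<psi> j) \<or> t (\<psi> i) (\<psi> j))"
    if "i < j" "j < k" for i j
    using mono[OF that] same[OF that] diff[OF that] eq'[OF that] eq[OF that] by auto
  then obtain a b d where abd: "a < b" "b < d" "d < k" "\<psi> a < \<psi> b" "\<psi> b < \<psi> d"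
    and tight: "\<forall>(i, j) \<in> {(a, b), (b, d), (a, d)}. t (\<psi> i) (\<psi> j) \<and> f' i j = f' (\<psi> i) (\<psi> j)"
    using rigid[unfolded rigid_pattern_def, rule_format, of \<psi>] range by blast
  have "\<forall>(i, j) \<in> {(a, b), (b, d), (a, d)}. t (\<psi> i) (\<psi> j) \<and> f i j = f (\<psi> i) (\<psi> j)"
    using tight abd eq eq'[of a b] eq'[of b d] eq'[of a d] by auto
  then show "\<exists>a b d. a < b \<and> b < d \<and> d < k \<and> \<psi> a < \<psi> b \<and> \<psi> b < \<psi> d \<and>
      (\<forall>(i, j) \<in> {(a, b), (b, d), (a, d)}. t (\<psi> i) (\<psi> j) \<and> f i j = f (\<psi> i) (\<psi> j))"
    using abd by blast
qed

lemma pattern_check_sound: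
  assumes check: "pattern_check k ts bs" and bs: "bs = map (\<lambda>(i, j). f i j) (pair_list k)"
    and k: "3 \<le> k"
  shows "\<exists>c t. rigid_pattern k f c t"
proof -
  let ?g = "tabulated k bs"
  have g: "f i j = ?g i j" if "i < j" "j < k" for i j
    using that by (simp add: tabulated_def bs map_of_zip_map set_pair_list)
  consider (hom) a b d where "a < b" "b < d" "d < k" "?g a b = ?g b d" "?g a d = ?g b d"
    | (cons) "\<forall>i \<in> set [0..<k - 1]. ?g i (Suc i) = ?g 0 1"
    | (tight) t where "\<forall>p \<in> set (mono_lists k k). rigid_check k ?g (\<not> ?g 0 1) (\<lambda>i j. (i, j) \<in> t) p"
  proof -
    have "(\<exists>(a, b, d) \<in> {(a, b, d). a < b \<and> b < d \<and> d < k}. ?g a b = ?g b d \<and> ?g a d = ?g b d) \<or>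
        (\<forall>i \<in> set [0..<k - 1]. ?g i (Suc i) = ?g 0 1) \<or>
        (\<exists>t\<in>set ts. \<forall>p \<in> set (mono_lists k k). rigid_check k ?g (\<not> ?g 0 1) (\<lambda>i j. (i, j) \<in> t) p)"
      using check unfolding pattern_check_def Let_def list_ex_iff list_all_iff set_triple_list .
    then show ?thesis
    proof (elim disjE)
      assume "\<exists>(a, b, d) \<in> {(a, b, d). a < b \<and> b < d \<and> d < k}. ?g a b = ?g b d \<and> ?g a d = ?g b d"
      then show ?thesis using that(1) by blast
    next
      assume "\<forall>i \<in> set [0..<k - 1]. ?g i (Suc i) = ?g 0 1"
      then show ?thesis by (rule that(2))
    next
      assume "\<exists>t\<in>set ts. \<forall>p \<in> set (mono_lists k k). rigid_check k ?g (\<not> ?g 0 1) (\<lambda>i j. (i, j) \<in> t) p"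
      then show ?thesis using that(3) by blast
    qed
  qed
  then have "\<exists>c t. rigid_pattern k ?g c t"
  proof cases
    case hom
    then show ?thesis using rigid_pattern_homogeneous[of a b d k ?g] by blast
  next
    case cons
    have "?g i (Suc i) = ?g 0 1" if "Suc i < k" for i
      by (rule cons[rule_format]) (use that in simp)
    then show ?thesis using rigid_pattern_consecutive[OF k, of ?g "?g 0 1"] by blast
  next
    case tight
    then show ?thesis using rigid_pattern_by_check by blast
  qed
  then show ?thesis using rigid_pattern_cong[of k f ?g, OF g] by blast
qed

text \<open>On three vertices the hypothesis makes both consecutive pairs equal. Four and five
  vertices are settled by computation, and from six on there is a homogeneous triple.\<close>

lemma ex_rigid_pattern:
  assumes k: "3 \<le> k" and not_D: "k = 3 \<Longrightarrow> f 0 1 = f 1 2"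
  shows "\<exists>c t. rigid_pattern k f c t"
proof -
  have bs: "map (\<lambda>(i, j). f i j) (pair_list k) \<in> set (List.n_lists (length (pair_list k)) [True, False])"
    by (auto simp: set_n_lists)
  consider "k = 3" | "k = 4" | "k = 5" | "6 \<le> k" using k by linarith
  then show ?thesis
  proof cases
    case 1
    have "f i (Suc i) = f 0 1" if "Suc i < k" for i
    proof -
      have "i = 0 \<or> i = 1" using that 1 by linarith
      then show ?thesis using not_D[OF 1] by (auto simp: numeral_2_eq_2)
    qed
    then show ?thesis using rigid_pattern_consecutive[OF k] by blast
  next
    case 2
    have "length (pair_list 4) = 6" by code_simp
    then show ?thesis using pattern_check_4 pattern_check_sound[OF _ refl k] bs 2 by (auto simp: list_all_iff)
  next
    case 3
    have "length (pair_list 5) = 10" by code_simp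
    then show ?thesis using pattern_check_5 pattern_check_sound[OF _ refl k] bs 3 by (auto simp: list_all_iff)
  next
    case 4
    obtain a b d where "a < b" "b < d" "d < 6" "f a b = f b d" "f a d = f b d"
      using ramsey_3_3 by blast
    then show ?thesis using rigid_pattern_homogeneous[of a b d k f] 4 by fastforce
  qed
qed

text \<open>On three vertices the condition leaves \<open>f 0 2\<close> free, hence exactly four
  patterns: the fork and its images under complementation and reversal.\<close>

theorem polynomial_pattern_removal_iff:
  assumes k: "2 \<le> k"
  shows "polynomial_pattern_removal k f \<longleftrightarrow> k = 2 \<or> k = 3 \<and> f 0 1 \<noteq> f 1 2"
proof
  assume "polynomial_pattern_removal k f"
  then show "k = 2 \<or> k = 3 \<and> f 0 1 \<noteq> f 1 2"
    using rigid_pattern_not_polynomial[of k f] ex_rigid_pattern[of k f] k by (cases "k = 2") auto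
next
  assume "k = 2 \<or> k = 3 \<and> f 0 1 \<noteq> f 1 2"
  then consider "k = 2" "f 0 1" | "k = 2" "\<not> f 0 1"
    | "k = 3" "f 0 1" "f 0 2" "\<not> f 1 2" | "k = 3" "\<not> f 0 1" "\<not> f 0 2" "f 1 2"
    | "k = 3" "\<not> f 0 1" "f 0 2" "f 1 2" | "k = 3" "f 0 1" "\<not> f 0 2" "\<not> f 1 2" by blast
  then show "polynomial_pattern_removal k f"
  proof cases
    case 1 then show ?thesis by (simp add: edge_removal)
  next
    case 2 then show ?thesis
      using polynomial_pattern_removal_complement[OF edge_removal[of "\<lambda>i j. \<not> f i j"]] by simp
  next
    case 3 then show ?thesis by (simp add: fork_pattern_removal)
  next
    case 4 then show ?thesis
      using polynomial_pattern_removal_complement[OF fork_pattern_removal[of "\<lambda>i j. \<not> f i j"]] by simp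
  next
    case 5
    \<comment> \<open>Reversal swaps the pairs (0, 1) and (1, 2) and fixes (0, 2), which turns
      \<open>f\<close> into a fork; reversing again recovers \<open>f\<close> on increasing
      pairs.\<close>
    let ?r = "\<lambda>i j. f (2 - j) (2 - i)"
    have "polynomial_pattern_removal 3 (\<lambda>i j. ?r (3 - 1 - j) (3 - 1 - i))"
      by (rule polynomial_pattern_removal_reverse, rule fork_pattern_removal) (use 5 in auto)
    also have "?this \<longleftrightarrow> polynomial_pattern_removal 3 f"
      by (rule polynomial_pattern_removal_cong) auto
    finally show ?thesis using 5 by simp
  next
    case 6
    let ?r = "\<lambda>i j. \<not> f (2 - j) (2 - i)"
    have "polynomial_pattern_removal 3 (\<lambda>i j. \<not> ?r (3 - 1 - j) (3 - 1 - i))"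
      by (rule polynomial_pattern_removal_complement, rule polynomial_pattern_removal_reverse,
          rule fork_pattern_removal) (use 6 in auto)
    also have "?this \<longleftrightarrow> polynomial_pattern_removal 3 f"
      by (rule polynomial_pattern_removal_cong) auto
    finally show ?thesis using 6 by simp
  qed
qed

section \<open>The characterisation\<close>

lemma enumerates_D: "enumerates (\<lambda>i. i) graph_D"
  by (auto simp: enumerates_def graph_D_def bij_betw_def)

lemma enumerates_complement: "enumerates e G \<Longrightarrow> enumerates e (graph_complement G)"
  by (simp add: enumerates_def graph_complement_def)

lemma enumerates_reverse:
  assumes "enumerates e G"
  shows "enumerates (\<lambda>i. e (card (verts G) - 1 - i)) (graph_reverse G)"
proof -
  let ?n = "card (verts G)"
  have "bij_betw (\<lambda>i. ?n - 1 - i) {..<?n} {..<?n}"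
    by (rule bij_betw_byWitness[where f' = "\<lambda>i. ?n - 1 - i"]) auto
  then have "bij_betw (\<lambda>i. e (?n - 1 - i)) {..<?n} (verts G)"
    using assms bij_betw_trans[of "\<lambda>i. ?n - 1 - i" "{..<?n}" "{..<?n}" e "verts G"]
    by (simp add: enumerates_def comp_def)
  then show ?thesis using assms by (auto simp: enumerates_def graph_reverse_def)
qed

text \<open>The four graphs realise precisely the four three-vertex patterns whose consecutive pairs
  have different colours.\<close>

lemma iso_D_types_iff:
  assumes F: "enumerates e F" and oF: "ordered_graph F"
  shows "(\<exists>H \<in> {graph_D, graph_reverse graph_D, graph_complement graph_D,
            graph_complement (graph_reverse graph_D)}. F \<cong>\<^sub>o H) \<longleftrightarrow>
    card (verts F) = 3 \<and> adjacent e F 0 1 \<noteq> adjacent e F 1 2"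
proof -
  have pairs: "(\<forall>i j. i < j \<longrightarrow> j < 3 \<longrightarrow> P i j) \<longleftrightarrow> P 0 1 \<and> P 0 2 \<and> P 1 2" for P :: "nat \<Rightarrow> nat \<Rightarrow> bool"
    by (auto simp: numeral_3_eq_3 numeral_2_eq_2 less_Suc_eq)
  have iso: "F \<cong>\<^sub>o H \<longleftrightarrow> card (verts F) = 3 \<and> adjacent e F 0 1 = adjacent h H 0 1 \<and>
      adjacent e F 0 2 = adjacent h H 0 2 \<and> adjacent e F 1 2 = adjacent h H 1 2"
    if "enumerates h H" "ordered_graph H" "verts H = verts graph_D" for H :: "nat ograph" and h
  proof -
    have "card (verts H) = 3" using that by (simp add: graph_D_def)
    then show ?thesis
      unfolding ograph_iso_iff[OF F that(1) oF that(2)]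
      by (cases "card (verts F) = 3") (simp_all only: pairs, simp_all)
  qed
  have mem: "{u, v} \<in> all_pairs {0, 1, 2 :: nat} \<longleftrightarrow> u \<in> {0, 1, 2} \<and> v \<in> {0, 1, 2} \<and> u \<noteq> v" for u v
    unfolding all_pairs_def by (auto simp: doubleton_eq_iff)
  note adj = adjacent_def graph_D_def graph_reverse_def graph_complement_def doubleton_eq_iff mem
    mem[unfolded One_nat_def]
  note oR = ordered_graph_reverse[OF ordered_graph_D] and eR = enumerates_reverse[OF enumerates_D]
  have "F \<cong>\<^sub>o graph_D \<longleftrightarrow> card (verts F) = 3 \<and>
      adjacent e F 0 1 \<and> adjacent e F 0 2 \<and> \<not> adjacent e F 1 2"
    by (subst iso[OF enumerates_D ordered_graph_D]) (simp_all add: adj)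
  moreover have "F \<cong>\<^sub>o graph_reverse graph_D \<longleftrightarrow> card (verts F) = 3 \<and>
      \<not> adjacent e F 0 1 \<and> adjacent e F 0 2 \<and> adjacent e F 1 2"
    by (subst iso[OF eR oR]) (simp_all add: adj)
  moreover have "F \<cong>\<^sub>o graph_complement graph_D \<longleftrightarrow> card (verts F) = 3 \<and>
      \<not> adjacent e F 0 1 \<and> \<not> adjacent e F 0 2 \<and> adjacent e F 1 2"
    by (subst iso[OF enumerates_complement[OF enumerates_D] ordered_graph_complement[OF ordered_graph_D]])
      (simp_all add: adj)
  moreover have "F \<cong>\<^sub>o graph_complement (graph_reverse graph_D) \<longleftrightarrow> card (verts F) = 3 \<and>
      adjacent e F 0 1 \<and> \<not> adjacent e F 0 2 \<and> \<not> adjacent e F 1 2"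
    by (subst iso[OF enumerates_complement[OF eR] ordered_graph_complement[OF oR]])
      (simp_all add: adj)
  ultimately show ?thesis by blast
qed

theorem theorem1p1:
  fixes F :: "'a ograph"
  assumes "ordered_graph F"
    and "card (verts F) \<ge> 2"
  shows "polynomial_induced_removal F \<longleftrightarrow>
    card (verts F) = 2 \<or>
    (\<exists>H \<in> {graph_D, graph_reverse graph_D, graph_complement graph_D,
            graph_complement (graph_reverse graph_D)}. F \<cong>\<^sub>o H)"
proof -
  obtain e where e: "enumerates e F" using ex_enumerates[OF assms(1)] by blast
  show ?thesis
    unfolding polynomial_induced_removal_iff[OF e] polynomial_pattern_removal_iff[OF assms(2)]
      iso_D_types_iff[OF e assms(1)] ..
qed

end
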